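(* For all integers $n,f$ with $1\le f\le n-2$, $\mathrm{Cons}(n,f+1)$ is not $C$-reducible to $\mathrm{Cons}(n,f)$.
   Context: Model: a finite set of processes runs an asynchronous algorithm communicating by reliable message passing with unbounded delays and speeds; processes fail only by crashing. Time is $\mathcal T=\mathbb N$; a failure pattern $F$ for $\Pi$ is a nondecreasing map $\mathcal T\to2^\Pi$, $Faulty(F)=\bigcup_tF(t)$. A task $T=(P,f)$ consists of a binary agreement problem $P$ (mapping $(F,\vec V)$, $\vec V\in\{0,1\}^\Pi$, to a nonempty $P(F,\vec V)\subseteq\{0,1\}$) and a resiliency degree $f$. An algorithm solves $T$ if in every run with $|Faulty(F)|\le f$ and initial values $\vec V$: every correct process eventually decides, decisions are irrevocable, no two processes decide differently, and decisions lie in $P(F,\vec V)$. Binary Consensus $\mathrm{Cons}(n,f)=(\mathrm{Cons}_{\Pi},f)$ on $\Pi=\{1,\dots,n\}$: $\mathrm{Cons}_\Pi(F,\vec V)=\{v\}$ if all entries of $\vec V$ equal $v$, and $\{0,1\}$ otherwise. Oracles: for $T=(P,f)$ on $\Pi$, $\mathcal O.T$ is a black box with consultants $\Pi$; its history is a sequence of successive consultations, in each of which every consultant may submit at most one query in $\{0,1\}$ and the oracle returns a common response $d$ with $d\in P(F,\vec V)$ for every $\vec V$ extending the partial query vector (the oracle may use the whole failure pattern, including future crashes), and every correct querier gets the response whenever at least $|\Pi|-f$ consultants query; $\mathcal O.T$ is the most general such oracle. $T_1\le_C T_2$ means there is an algorithm solving $T_1$ whose processes, besides message passing, may consult (repeatedly,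 waiting for each answer) the oracle $\mathcal O.T_2$. *)

theory Defs
  imports Main
begin

text \<open>Processes are natural numbers; the process set is an explicit set Pi.
  Time is nat.  Binary values are bool (False = 0, True = 1).\<close>

type_synonym fpattern = "nat \<Rightarrow> nat set"

definition failure_pattern :: "nat set \<Rightarrow> fpattern \<Rightarrow> bool" where
  "failure_pattern Pi F \<longleftrightarrow> mono F \<and> (\<forall>t. F t \<subseteq> Pi)"

definition faulty :: "fpattern \<Rightarrow> nat set" where
  "faulty F = \<Union> (range F)"

definition correct :: "nat set \<Rightarrow> fpattern \<Rightarrow> nat set" where
  "correct Pi F = Pi - faulty F"

text \<open>A binary agreement problem maps a failure pattern and an initial-value
  vector to a set of admissible decision values; a task is a problem together
  with a resiliency degree.\<close>

type_synonym problem = "fpattern \<Rightarrow> (nat \<Rightarrow> bool) \<Rightarrow> bool set"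
type_synonym task = "problem \<times> nat"

definition cons_problem :: "nat set \<Rightarrow> problem" where
  "cons_problem Pi F V =
     (if \<exists>v. \<forall>p\<in>Pi. V p = v then {v. \<forall>p\<in>Pi. V p = v} else UNIV)"

definition Cons_task :: "nat \<Rightarrow> nat \<Rightarrow> task" where
  "Cons_task n f = (cons_problem {1..n}, f)"

datatype 'm inp = NullIn | MsgIn nat 'm | RespIn bool

definition is_msg :: "'m inp \<Rightarrow> bool" where
  "is_msg i = (case i of MsgIn _ _ \<Rightarrow> True | _ \<Rightarrow> False)"

definition is_resp :: "'m inp \<Rightarrow> bool" where
  "is_resp i = (case i of RespIn _ \<Rightarrow> True | _ \<Rightarrow> False)"

text \<open>An algorithm: for each process an initial state (depending on its initial
  value), a deterministic transition function (new state, list of messages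
  (destination, content) to send, optional oracle query), and a decision
  read off the local state.\<close>

record ('s, 'm) algorithm =
  a_init  :: "nat \<Rightarrow> bool \<Rightarrow> 's"
  a_trans :: "nat \<Rightarrow> 's \<Rightarrow> 'm inp \<Rightarrow> 's \<times> (nat \<times> 'm) list \<times> bool option"
  a_dec   :: "nat \<Rightarrow> 's \<Rightarrow> bool option"

text \<open>A (candidate) run: which process steps at each time (if any), the input of
  that step, for message receipts the sending event (time, index in the send
  list), and the common response of each oracle consultation.\<close>

record 'm schedule =
  sched :: "nat \<Rightarrow> nat option"
  input :: "nat \<Rightarrow> 'm inp"
  src   :: "nat \<Rightarrow> nat \<times> nat"
  resp  :: "nat \<Rightarrow> bool"

fun cfg :: "('s, 'm) algorithm \<Rightarrow> (nat \<Rightarrow> bool) \<Rightarrow> 'm schedule \<Rightarrow> nat \<Rightarrow> nat \<Rightarrow> 's" where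
  "cfg A V r 0 = (\<lambda>p. a_init A p (V p))"
| "cfg A V r (Suc t) =
     (case sched r t of
        None \<Rightarrow> cfg A V r t
      | Some p \<Rightarrow> (cfg A V r t)(p := fst (a_trans A p (cfg A V r t p) (input r t))))"

definition sends :: "('s, 'm) algorithm \<Rightarrow> (nat \<Rightarrow> bool) \<Rightarrow> 'm schedule \<Rightarrow> nat \<Rightarrow> (nat \<times> 'm) list" where
  "sends A V r t = (case sched r t of None \<Rightarrow> []
      | Some p \<Rightarrow> fst (snd (a_trans A p (cfg A V r t p) (input r t))))"

definition qout :: "('s, 'm) algorithm \<Rightarrow> (nat \<Rightarrow> bool) \<Rightarrow> 'm schedule \<Rightarrow> nat \<Rightarrow> bool option" where
  "qout A V r t = (case sched r t of None \<Rightarrow> None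
      | Some p \<Rightarrow> snd (snd (a_trans A p (cfg A V r t p) (input r t))))"

text \<open>Number of oracle queries issued / responses received by p before time t.
  The k-th query (counting from 0) of a process belongs to consultation k.\<close>

definition nq :: "('s, 'm) algorithm \<Rightarrow> (nat \<Rightarrow> bool) \<Rightarrow> 'm schedule \<Rightarrow> nat \<Rightarrow> nat \<Rightarrow> nat" where
  "nq A V r t p = card {t'. t' < t \<and> sched r t' = Some p \<and> qout A V r t' \<noteq> None}"

definition nr :: "'m schedule \<Rightarrow> nat \<Rightarrow> nat \<Rightarrow> nat" where
  "nr r t p = card {t'. t' < t \<and> sched r t' = Some p \<and> is_resp (input r t')}"

definition waiting :: "('s, 'm) algorithm \<Rightarrow> (nat \<Rightarrow> bool) \<Rightarrow> 'm schedule \<Rightarrow> nat \<Rightarrow> nat \<Rightarrow> bool" where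
  "waiting A V r t p \<longleftrightarrow> nr r t p < nq A V r t p"

definition blocked :: "('s, 'm) algorithm \<Rightarrow> (nat \<Rightarrow> bool) \<Rightarrow> 'm schedule \<Rightarrow> nat \<Rightarrow> bool" where
  "blocked A V r p \<longleftrightarrow> (\<exists>t0. \<forall>t\<ge>t0. sched r t \<noteq> Some p \<and> waiting A V r t p)"

definition queried :: "('s, 'm) algorithm \<Rightarrow> (nat \<Rightarrow> bool) \<Rightarrow> 'm schedule \<Rightarrow> nat \<Rightarrow> nat \<Rightarrow> nat \<Rightarrow> bool \<Rightarrow> bool" where
  "queried A V r T k p b \<longleftrightarrow>
     (\<exists>t<T. sched r t = Some p \<and> nq A V r t p = k \<and> qout A V r t = Some b)"

definition queried_ever :: "('s, 'm) algorithm \<Rightarrow> (nat \<Rightarrow> bool) \<Rightarrow> 'm schedule \<Rightarrow> nat \<Rightarrow> nat \<Rightarrow> bool" where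
  "queried_ever A V r k p \<longleftrightarrow>
     (\<exists>t b. sched r t = Some p \<and> nq A V r t p = k \<and> qout A V r t = Some b)"

text \<open>Admissible runs of A on process set Pi, with failure pattern F, initial
  values V, and access to the most general oracle O.(P2, f2) with consultants Pi.\<close>

definition is_run :: "('s, 'm) algorithm \<Rightarrow> nat set \<Rightarrow> fpattern \<Rightarrow> (nat \<Rightarrow> bool)
    \<Rightarrow> problem \<Rightarrow> nat \<Rightarrow> 'm schedule \<Rightarrow> bool" where
  "is_run A Pi F V P2 f2 r \<longleftrightarrow>
     \<comment> \<open>only alive processes of Pi take steps\<close>
     (\<forall>t p. sched r t = Some p \<longrightarrow> p \<in> Pi \<and> p \<notin> F t)
     \<comment> \<open>a waiting process can only receive the response of its pending
         consultation; otherwise a step is a null step or receives a message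
         previously sent to it\<close>
   \<and> (\<forall>t p. sched r t = Some p \<longrightarrow>
        (if waiting A V r t p then input r t = RespIn (resp r (nr r t p))
         else input r t = NullIn \<or>
           (\<exists>q m. input r t = MsgIn q m \<and> fst (src r t) < t
              \<and> sched r (fst (src r t)) = Some q
              \<and> snd (src r t) < length (sends A V r (fst (src r t)))
              \<and> sends A V r (fst (src r t)) ! snd (src r t) = (p, m))))
     \<comment> \<open>no message is received twice\<close>
   \<and> (\<forall>t t'. sched r t \<noteq> None \<and> sched r t' \<noteq> None \<and> is_msg (input r t)
        \<and> is_msg (input r t') \<and> src r t = src r t' \<longrightarrow> t = t')
     \<comment> \<open>reliable channels: messages to correct processes are received\<close>
   \<and> (\<forall>t i p m. i < length (sends A V r t) \<and> sends A V r t ! i = (p, m)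
        \<and> p \<in> correct Pi F \<longrightarrow>
        (\<exists>t'. sched r t' = Some p \<and> is_msg (input r t') \<and> src r t' = (t, i))
        \<or> blocked A V r p)
     \<comment> \<open>correct processes take infinitely many steps unless blocked on the oracle\<close>
   \<and> (\<forall>p\<in>correct Pi F. (\<forall>t. \<exists>t'\<ge>t. sched r t' = Some p) \<or> blocked A V r p)
     \<comment> \<open>oracle safety: the common response of consultation k is admissible for
         every vector extending the queries of consultation k submitted so far\<close>
   \<and> (\<forall>t p. sched r t = Some p \<and> is_resp (input r t) \<longrightarrow>
        (\<forall>W. (\<forall>q b. queried A V r t (nr r t p) q b \<longrightarrow> W q = b)
             \<longrightarrow> resp r (nr r t p) \<in> P2 F W))
     \<comment> \<open>oracle liveness: if at least |Pi| - f2 consultants query in consultation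
         k, every correct querier gets the response\<close>
   \<and> (\<forall>p k. p \<in> correct Pi F \<and> queried_ever A V r k p
        \<and> card {q\<in>Pi. queried_ever A V r k q} \<ge> card Pi - f2 \<longrightarrow>
        (\<exists>t. sched r t = Some p \<and> is_resp (input r t) \<and> nr r t p = k))"

definition solves_with :: "('s, 'm) algorithm \<Rightarrow> nat set \<Rightarrow> task \<Rightarrow> task \<Rightarrow> bool" where
  "solves_with A Pi T1 T2 \<longleftrightarrow>
     (\<forall>F V r. failure_pattern Pi F \<and> card (faulty F) \<le> snd T1
        \<and> is_run A Pi F V (fst T2) (snd T2) r \<longrightarrow>
        (\<forall>p\<in>correct Pi F. \<exists>t d. a_dec A p (cfg A V r t p) = Some d)
      \<and> (\<forall>p\<in>Pi. \<forall>t t' d. t \<le> t' \<and> a_dec A p (cfg A V r t p) = Some d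
            \<longrightarrow> a_dec A p (cfg A V r t' p) = Some d)
      \<and> (\<forall>p\<in>Pi. \<forall>q\<in>Pi. \<forall>t t' d d'. a_dec A p (cfg A V r t p) = Some d
            \<and> a_dec A q (cfg A V r t' q) = Some d' \<longrightarrow> d = d')
      \<and> (\<forall>p\<in>Pi. \<forall>t d. a_dec A p (cfg A V r t p) = Some d \<longrightarrow> d \<in> fst T1 F V))"

end

theory Submission
  imports Defs
begin

text \<open>If \<open>f + 1\<close> processes crash before submitting a query, a consultation receives at most
  \<open>n - f - 1\<close> queries and need not be answered. Hence a process that is the first to query must
  already have decided, as it may be blocked for ever: before the first decision no process
  consults the oracle. On query-free prefixes a bivalence argument applies. Since \<open>f + 1 \<ge> 2\<close>, the
  two processes whose steps distinguish neighbouring configurations of opposite valency can both be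
  crashed, and the decision that the others reach without the oracle is compatible with both
  configurations.\<close>

section \<open>Prefixes of schedules\<close>

type_synonym 'm event = "nat option \<times> 'm inp \<times> nat \<times> nat"

definition event :: "'m schedule \<Rightarrow> nat \<Rightarrow> 'm event" where
  "event r s = (sched r s, input r s, src r s)"

definition schedule_of :: "(nat \<Rightarrow> 'm event) \<Rightarrow> (nat \<Rightarrow> bool) \<Rightarrow> 'm schedule" where
  "schedule_of e d = \<lparr>sched = \<lambda>s. fst (e s), input = \<lambda>s. fst (snd (e s)),
     src = \<lambda>s. snd (snd (e s)), resp = d\<rparr>"

definition idle :: "'m event" where
  "idle = (None, NullIn, 0, 0)"

definition continue_with :: "'m schedule \<Rightarrow> nat \<Rightarrow> 'm event \<Rightarrow> 'm schedule" where
  "continue_with r t e = schedule_of (\<lambda>s. if s < t then event r s else e) (resp r)"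

definition graft :: "'m schedule \<Rightarrow> 'm schedule \<Rightarrow> nat \<Rightarrow> 'm schedule" where
  "graft r r' t = schedule_of (\<lambda>s. if s < t then event r s else event r' s) (resp r')"

definition agree :: "'m schedule \<Rightarrow> 'm schedule \<Rightarrow> nat \<Rightarrow> bool" where
  "agree r r' t \<longleftrightarrow> (\<forall>s<t. event r s = event r' s)"

lemma schedule_of_simps [simp]:
  "event (schedule_of e d) s = e s"
  "resp (schedule_of e d) = d"
  by (simp_all add: schedule_of_def event_def)

lemma event_eqD:
  assumes "event r s = event r' s'"
  shows "sched r s = sched r' s'" "input r s = input r' s'" "src r s = src r' s'"
  using assms by (simp_all add: event_def)

lemma event_continue_with:
  "event (continue_with r t e) s = (if s < t then event r s else e)"
  by (simp add: continue_with_def)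

lemma continue_with_here [simp]:
  "sched (continue_with r t (a, inp, x)) t = a"
  "input (continue_with r t (a, inp, x)) t = inp"
  "src (continue_with r t (a, inp, x)) t = x"
  by (simp_all add: continue_with_def schedule_of_def)

lemma sched_continue_with_idle: "t \<le> s \<Longrightarrow> sched (continue_with r t idle) s = None"
  by (simp add: continue_with_def schedule_of_def idle_def)

lemma event_graft: "event (graft r r' t) s = (if s < t then event r s else event r' s)"
  by (simp add: graft_def)

lemma is_msg_simps [simp]: "\<not> is_msg NullIn" "is_msg (MsgIn q m)" "\<not> is_msg (RespIn b)"
  by (simp_all add: is_msg_def)

lemma is_resp_simps [simp]: "\<not> is_resp NullIn" "\<not> is_resp (MsgIn q m)" "is_resp (RespIn b)"
  by (simp_all add: is_resp_def)

lemma agree_refl [simp]: "agree r r t"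
  by (simp add: agree_def)

lemma agree_sym: "agree r r' t \<Longrightarrow> agree r' r t"
  by (simp add: agree_def)

lemma agree_trans: "agree r r' t \<Longrightarrow> agree r' r'' t \<Longrightarrow> agree r r'' t"
  by (simp add: agree_def)

lemma agree_mono: "agree r r' t \<Longrightarrow> s \<le> t \<Longrightarrow> agree r r' s"
  by (simp add: agree_def)

lemma agree_continue_with [simp]: "agree r (continue_with r t e) t"
  by (simp add: agree_def event_continue_with)

lemma agree_graft: "agree r (graft r r' t) t"
  by (simp add: agree_def event_graft)

lemma agreeD:
  assumes "agree r r' t" "s < t"
  shows "sched r s = sched r' s" "input r s = input r' s" "src r s = src r' s"
  using assms by (auto simp: agree_def dest: event_eqD)

lemma agree_limit:
  assumes "strict_mono T" and consecutive: "\<And>j. agree (R j) (R (Suc j)) (T j)"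
  obtains r where "\<And>j. agree (R j) r (T j)"
proof
  have chain: "agree (R j) (R k) (T j)" if "j \<le> k" for j k
    using that
  proof (induction k rule: dec_induct)
    case (step k)
    have "T j \<le> T k" using \<open>strict_mono T\<close> step.hyps by (simp add: strict_mono_less_eq)
    then have "agree (R k) (R (Suc k)) (T j)" using consecutive agree_mono by blast
    with step.IH show ?case by (rule agree_trans)
  qed simp
  fix j
  let ?limit = "schedule_of (\<lambda>s. event (R (Suc s)) s) undefined"
  show "agree (R j) ?limit (T j)"
    unfolding agree_def
  proof (intro allI impI)
    fix s assume "s < T j"
    let ?k = "max j (Suc s)"
    have "s < T (Suc s)" using strict_mono_imp_increasing[OF \<open>strict_mono T\<close>, of "Suc s"] by simp
    then have "event (R (Suc s)) s = event (R ?k) s"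
      using chain[of "Suc s" ?k] by (simp add: agree_def)
    moreover have "event (R j) s = event (R ?k) s"
      using chain[of j ?k] \<open>s < T j\<close> by (simp add: agree_def)
    ultimately show "event (R j) s = event ?limit s" by simp
  qed
qed

lemma dependent_limit:
  assumes base: "P 0 r0 t0"
    and step: "\<And>j r t. P j r t \<Longrightarrow> \<exists>r' t'. t < t' \<and> agree r r' t \<and> P (Suc j) r' t'"
  obtains r T where "strict_mono T" "\<And>j. \<exists>r'. P j r' (T j) \<and> agree r' r (T j)"
proof -
  have "\<exists>g. \<forall>j. P j (fst (g j)) (snd (g j)) \<and>
      snd (g j) < snd (g (Suc j)) \<and> agree (fst (g j)) (fst (g (Suc j))) (snd (g j))"
  proof (rule dependent_nat_choice)
    show "\<exists>x. P 0 (fst x) (snd x)" using base by auto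
    fix x j assume "P j (fst x) (snd x)"
    then show "\<exists>y. P (Suc j) (fst y) (snd y) \<and> snd x < snd y \<and> agree (fst x) (fst y) (snd x)"
      using step[of j "fst x" "snd x"] by (metis fst_conv snd_conv)
  qed
  then obtain g where chain: "\<And>j. P j (fst (g j)) (snd (g j))"
      "\<And>j. snd (g j) < snd (g (Suc j))" "\<And>j. agree (fst (g j)) (fst (g (Suc j))) (snd (g j))"
    by blast
  have "strict_mono (\<lambda>j. snd (g j))" using chain(2) by (simp add: strict_mono_Suc_iff)
  then show thesis using agree_limit[of "\<lambda>j. snd (g j)" "\<lambda>j. fst (g j)"] chain that by metis
qed

lemma stepwise_extension:
  assumes ex: "\<And>r s. \<exists>e. Q (continue_with r s e) s"
    and prefix: "\<And>r r' s. agree r r' (Suc s) \<Longrightarrow> Q r s \<Longrightarrow> Q r' s"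
  obtains r' where "agree r r' t" "\<And>s. t \<le> s \<Longrightarrow> Q r' s"
proof -
  define P where "P = (\<lambda>j r' s. s = t + j \<and> agree r r' t \<and> (\<forall>u. t \<le> u \<and> u < s \<longrightarrow> Q r' u))"
  have step: "\<exists>r' s'. s < s' \<and> agree r1 r' s \<and> P (Suc j) r' s'" if P: "P j r1 s" for j r1 s
  proof -
    obtain e where e: "Q (continue_with r1 s e) s" using ex by blast
    let ?r = "continue_with r1 s e"
    have "Q ?r u" if "t \<le> u" "u < Suc s" for u
    proof (cases "u = s")
      case False
      then have "agree r1 ?r (Suc u)" using \<open>u < Suc s\<close> by (auto intro: agree_mono[of _ _ s])
      then show ?thesis using prefix P that False unfolding P_def by auto
    qed (use e in simp)
    moreover have "agree r ?r t"
      using P agree_trans[OF _ agree_mono[of r1 ?r s t]] unfolding P_def by simp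
    ultimately show ?thesis using P by (intro exI[of _ ?r] exI[of _ "Suc s"]) (auto simp: P_def)
  qed
  have base: "P 0 r t" by (auto simp: P_def)
  obtain r' T where limit: "\<And>j. \<exists>r1. P j r1 (T j) \<and> agree r1 r' (T j)"
    by (rule dependent_limit[of P, OF base step]) (assumption | rule that)+
  show thesis
  proof
    show "agree r r' t"
      using limit[of 0] agree_trans unfolding P_def by (metis add_0_right)
    fix s assume "t \<le> s"
    obtain r1 where "P (Suc (s - t)) r1 (T (Suc (s - t)))" "agree r1 r' (T (Suc (s - t)))"
      using limit by blast
    then have "Q r1 s" "agree r1 r' (Suc s)" using \<open>t \<le> s\<close> unfolding P_def by auto
    then show "Q r' s" using prefix by blast
  qed
qed

lemma cfg_agree: "agree r r' t \<Longrightarrow> s \<le> t \<Longrightarrow> cfg A V r s = cfg A V r' s"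
proof (induction s)
  case (Suc s)
  then show ?case by (auto simp: agreeD[of r r' t s] fun_eq_iff split: option.split)
qed simp

lemma sends_agree: "agree r r' t \<Longrightarrow> s < t \<Longrightarrow> sends A V r s = sends A V r' s"
  by (simp add: sends_def agreeD[of r r' t s] cfg_agree[of r r' t s] split: option.split)

lemma qout_agree: "agree r r' t \<Longrightarrow> s < t \<Longrightarrow> qout A V r s = qout A V r' s"
  by (simp add: qout_def agreeD[of r r' t s] cfg_agree[of r r' t s] split: option.split)

lemma nq_agree: "agree r r' t \<Longrightarrow> s \<le> t \<Longrightarrow> nq A V r s p = nq A V r' s p"
  unfolding nq_def
  by (rule arg_cong[where f = card], intro Collect_cong)
     (metis agreeD(1) qout_agree order_less_le_trans)

lemma nr_agree: "agree r r' t \<Longrightarrow> s \<le> t \<Longrightarrow> nr r s p = nr r' s p"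
  unfolding nr_def
  by (rule arg_cong[where f = card], intro Collect_cong)
     (metis agreeD(1,2) order_less_le_trans)

lemma waiting_agree: "agree r r' t \<Longrightarrow> s \<le> t \<Longrightarrow> waiting A V r s p = waiting A V r' s p"
  by (simp add: waiting_def nq_agree[of r r' t] nr_agree[of r r' t])

lemma queried_agree: "agree r r' t \<Longrightarrow> queried A V r t k p b \<Longrightarrow> queried A V r' t k p b"
  unfolding queried_def by (metis agreeD(1) nq_agree qout_agree less_imp_le)

lemma cfg_unscheduled:
  assumes "s \<le> t" "\<And>u. s \<le> u \<Longrightarrow> u < t \<Longrightarrow> sched r u \<noteq> Some p"
  shows "cfg A V r t p = cfg A V r s p"
  using assms
proof (induction t rule: dec_induct)
  case (step t)
  then have "sched r t \<noteq> Some p" by simp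
  with step show ?case by (auto split: option.split)
qed simp

lemma sends_unscheduled: "sched r t = None \<Longrightarrow> sends A V r t = []"
  by (simp add: sends_def)

lemma qout_unscheduled: "sched r t = None \<Longrightarrow> qout A V r t = None"
  by (simp add: qout_def)

lemma nq_pos_iff: "0 < nq A V r t p \<longleftrightarrow> (\<exists>s<t. sched r s = Some p \<and> qout A V r s \<noteq> None)"
  unfolding nq_def by (auto simp: card_gt_0_iff)

lemma nr_pos_iff: "0 < nr r t p \<longleftrightarrow> (\<exists>s<t. sched r s = Some p \<and> is_resp (input r s))"
  unfolding nr_def by (auto simp: card_gt_0_iff)

lemma nr_unscheduled: "sched r t \<noteq> Some p \<Longrightarrow> nr r (Suc t) p = nr r t p"
  unfolding nr_def by (auto intro!: arg_cong[where f = card] simp: less_Suc_eq)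

lemma waiting_unscheduled:
  assumes "sched r t \<noteq> Some p"
  shows "waiting A V r (Suc t) p = waiting A V r t p"
proof -
  have "nq A V r (Suc t) p = nq A V r t p"
    unfolding nq_def using assms by (auto intro!: arg_cong[where f = card] simp: less_Suc_eq)
  then show ?thesis by (simp add: waiting_def nr_unscheduled[OF assms])
qed

lemma waits_forever_if_unserved:
  assumes "waiting A V r s p"
    and unserved: "\<And>u. s \<le> u \<Longrightarrow> waiting A V r u p \<Longrightarrow> nr r u p = nr r s p \<Longrightarrow> sched r u \<noteq> Some p"
    and "s \<le> u"
  shows "waiting A V r u p \<and> sched r u \<noteq> Some p"
proof -
  have "waiting A V r u p \<and> nr r u p = nr r s p"
    using \<open>s \<le> u\<close>
  proof (induction u rule: dec_induct)
    case (step u)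
    then have "sched r u \<noteq> Some p" using unserved by blast
    then show ?case using step.IH waiting_unscheduled nr_unscheduled by metis
  qed (use assms(1) in simp)
  then show ?thesis using unserved \<open>s \<le> u\<close> by blast
qed

definition query_free :: "('s, 'm) algorithm \<Rightarrow> (nat \<Rightarrow> bool) \<Rightarrow> 'm schedule \<Rightarrow> nat \<Rightarrow> bool" where
  "query_free A V r t \<longleftrightarrow> (\<forall>s<t. qout A V r s = None)"

lemma query_free_0 [simp]: "query_free A V r 0"
  by (simp add: query_free_def)

lemma query_free_Suc: "query_free A V r (Suc t) \<longleftrightarrow> query_free A V r t \<and> qout A V r t = None"
  by (auto simp: query_free_def less_Suc_eq)

lemma query_free_mono: "query_free A V r t \<Longrightarrow> s \<le> t \<Longrightarrow> query_free A V r s"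
  by (simp add: query_free_def)

lemma query_free_agree: "agree r r' t \<Longrightarrow> query_free A V r t \<Longrightarrow> query_free A V r' t"
  using qout_agree unfolding query_free_def by metis

lemma query_free_not_waiting: "query_free A V r t \<Longrightarrow> \<not> waiting A V r t p"
  using nq_pos_iff[of A V r t p] by (auto simp: waiting_def query_free_def)

lemma query_free_continue_idle:
  assumes "query_free A V r t"
  shows "query_free A V (continue_with r t idle) u"
  unfolding query_free_def
proof (intro allI impI)
  fix s
  show "qout A V (continue_with r t idle) s = None"
  proof (cases "s < t")
    case True
    then show ?thesis
      using query_free_agree[OF agree_continue_with assms] by (simp add: query_free_def)
  qed (simp add: qout_unscheduled sched_continue_with_idle)
qed

lemma queried_if_not_query_free:
  assumes "\<not> query_free A V r t"
  obtains p b where "queried A V r t 0 p b"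
proof -
  have "\<exists>s. s < t \<and> qout A V r s \<noteq> None"
    using assms by (auto simp: query_free_def)
  then obtain s where s: "s < t" "qout A V r s \<noteq> None" "query_free A V r s"
    unfolding query_free_def by (subst (asm) exists_least_iff) (metis less_trans)
  then obtain p b where p: "sched r s = Some p" "qout A V r s = Some b"
    using qout_unscheduled by (metis not_None_eq)
  have "nq A V r s p = 0"
    using s(3) nq_pos_iff[of A V r s p] by (auto simp: query_free_def)
  then show thesis using that s(1) p unfolding queried_def by blast
qed

section \<open>Legal prefixes and fair steps\<close>

definition valid_receipt ::
    "('s, 'm) algorithm \<Rightarrow> (nat \<Rightarrow> bool) \<Rightarrow> 'm schedule \<Rightarrow> nat \<Rightarrow> nat \<Rightarrow> bool" where
  "valid_receipt A V r t p \<longleftrightarrow> (\<exists>q m. input r t = MsgIn q m \<and> fst (src r t) < t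
      \<and> sched r (fst (src r t)) = Some q
      \<and> snd (src r t) < length (sends A V r (fst (src r t)))
      \<and> sends A V r (fst (src r t)) ! snd (src r t) = (p, m))"

definition receipts :: "'m schedule \<Rightarrow> nat set" where
  "receipts r = {t. sched r t \<noteq> None \<and> is_msg (input r t)}"

definition legal_step ::
    "('s, 'm) algorithm \<Rightarrow> nat set \<Rightarrow> (nat \<Rightarrow> bool) \<Rightarrow> 'm schedule \<Rightarrow> nat \<Rightarrow> nat \<Rightarrow> bool" where
  "legal_step A Pi V r t p \<longleftrightarrow>
     p \<in> Pi \<and> \<not> waiting A V r t p \<and> (input r t = NullIn \<or> valid_receipt A V r t p)"

definition legal :: "('s, 'm) algorithm \<Rightarrow> nat set \<Rightarrow> (nat \<Rightarrow> bool) \<Rightarrow> 'm schedule \<Rightarrow> nat \<Rightarrow> bool" where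
  "legal A Pi V r t \<longleftrightarrow>
     (\<forall>s<t. \<forall>p. sched r s = Some p \<longrightarrow> legal_step A Pi V r s p)
   \<and> inj_on (src r) (receipts r \<inter> {..<t})"

definition pending ::
    "('s, 'm) algorithm \<Rightarrow> (nat \<Rightarrow> bool) \<Rightarrow> 'm schedule \<Rightarrow> nat \<Rightarrow> nat \<Rightarrow> (nat \<times> nat) set" where
  "pending A V r t p = {(s, i). s < t \<and> i < length (sends A V r s) \<and> fst (sends A V r s ! i) = p
      \<and> \<not> (\<exists>s'<t. sched r s' = Some p \<and> is_msg (input r s') \<and> src r s' = (s, i))}"

text \<open>Minimality of the sending time prevents a message from being overtaken for ever.\<close>

definition fair_step :: "('s, 'm) algorithm \<Rightarrow> (nat \<Rightarrow> bool) \<Rightarrow> 'm schedule \<Rightarrow> nat \<Rightarrow> nat \<Rightarrow> bool" where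
  "fair_step A V r t p \<longleftrightarrow> sched r t = Some p \<and> \<not> waiting A V r t p \<and>
     (if pending A V r t p = {} then input r t = NullIn
      else valid_receipt A V r t p \<and> src r t \<in> pending A V r t p
         \<and> (\<forall>x\<in>pending A V r t p. fst (src r t) \<le> fst x))"

lemma valid_receipt_agree:
  assumes "agree r r' (Suc t)" "valid_receipt A V r t p"
  shows "valid_receipt A V r' t p"
  using assms(2) unfolding valid_receipt_def
  by (metis agreeD[OF assms(1)] sends_agree[OF assms(1)] lessI less_Suc_eq)

lemma valid_receipt_is_msg: "valid_receipt A V r t p \<Longrightarrow> is_msg (input r t)"
  by (auto simp: valid_receipt_def)

lemma valid_receipt_receiver_unique:
  assumes "valid_receipt A V r s p" "valid_receipt A V r t q" "src r s = src r t"
  shows "p = q"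
  using assms by (auto simp: valid_receipt_def)

lemma receiptsE:
  assumes "t \<in> receipts r"
  obtains p where "sched r t = Some p" "is_msg (input r t)"
  using assms unfolding receipts_def by blast

lemma receipts_agree: "agree r r' t \<Longrightarrow> receipts r \<inter> {..<t} = receipts r' \<inter> {..<t}"
  by (auto simp: receipts_def agreeD)

lemma legal_step_agree:
  assumes "agree r r' (Suc t)" "legal_step A Pi V r t p"
  shows "legal_step A Pi V r' t p"
  using assms(2) valid_receipt_agree[OF assms(1)] waiting_agree[OF assms(1), of t A V p]
    agreeD(2)[OF assms(1), of t] by (auto simp: legal_step_def)

lemma legal_step_no_resp: "legal_step A Pi V r t p \<Longrightarrow> \<not> is_resp (input r t)"
  by (auto simp: legal_step_def valid_receipt_def)

lemma legal_step_receipt: "legal_step A Pi V r t p \<Longrightarrow> is_msg (input r t) \<Longrightarrow> valid_receipt A V r t p"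
  by (auto simp: legal_step_def)

lemma legal_0 [simp]: "legal A Pi V r 0"
  by (simp add: legal_def)

lemma legalD: "legal A Pi V r t \<Longrightarrow> s < t \<Longrightarrow> sched r s = Some p \<Longrightarrow> legal_step A Pi V r s p"
  by (simp add: legal_def)

lemma legal_inj: "legal A Pi V r t \<Longrightarrow> inj_on (src r) (receipts r \<inter> {..<t})"
  by (simp add: legal_def)

lemma legal_agree:
  assumes "agree r r' t" "legal A Pi V r t"
  shows "legal A Pi V r' t"
  unfolding legal_def
proof (intro conjI allI impI)
  fix s p assume s: "s < t" and "sched r' s = Some p"
  then have "legal_step A Pi V r s p" using legalD[OF assms(2)] agreeD(1)[OF assms(1)] by simp
  then show "legal_step A Pi V r' s p"
    using legal_step_agree[OF agree_mono[OF assms(1) Suc_leI[OF s]]] by blast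
next
  have "inj_on (src r) (receipts r' \<inter> {..<t}) \<longleftrightarrow> inj_on (src r') (receipts r' \<inter> {..<t})"
    by (rule inj_on_cong) (simp add: agreeD(3)[OF assms(1)])
  then show "inj_on (src r') (receipts r' \<inter> {..<t})"
    using legal_inj[OF assms(2)] receipts_agree[OF assms(1)] by simp
qed

lemma legal_mono: "legal A Pi V r t \<Longrightarrow> s \<le> t \<Longrightarrow> legal A Pi V r s"
  unfolding legal_def by (auto intro: inj_on_subset)

lemma legal_Suc:
  assumes "legal A Pi V r t"
    and "\<And>p. sched r t = Some p \<Longrightarrow> legal_step A Pi V r t p"
    and "\<And>s. t \<in> receipts r \<Longrightarrow> s \<in> receipts r \<Longrightarrow> s < t \<Longrightarrow> src r s \<noteq> src r t"
  shows "legal A Pi V r (Suc t)"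
  using assms unfolding legal_def
  by (auto simp: less_Suc_eq lessThan_Suc Int_insert_right image_iff) (metis)

lemma legal_continue_idle:
  assumes "legal A Pi V r t"
  shows "legal A Pi V (continue_with r t idle) u"
proof (induction u)
  case (Suc u)
  show ?case
  proof (cases "u < t")
    case True
    then show ?thesis using legal_mono[OF legal_agree[OF agree_continue_with assms]] by simp
  next
    case False
    then show ?thesis
      using Suc by (intro legal_Suc) (simp_all add: receipts_def sched_continue_with_idle)
  qed
qed simp

lemma legal_nr:
  assumes "legal A Pi V r t" "s \<le> t"
  shows "nr r s p = 0"
proof (rule ccontr)
  assume "nr r s p \<noteq> 0"
  then obtain u where "u < s" "sched r u = Some p" "is_resp (input r u)"
    using nr_pos_iff[of r s p] by auto
  then show False using legal_step_no_resp legalD[OF assms(1)] assms(2) by (metis less_le_trans)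
qed

lemma pending_agree:
  assumes "agree r r' t"
  shows "pending A V r t p = pending A V r' t p"
  unfolding pending_def using agreeD[OF assms] sends_agree[OF assms, of _ A V] by auto

lemma pending_receivable:
  assumes "(s, i) \<in> pending A V r t p"
  obtains inp where "valid_receipt A V (continue_with r t (Some p, inp, s, i)) t p"
proof -
  have s: "s < t" "i < length (sends A V r s)" "fst (sends A V r s ! i) = p"
    using assms by (auto simp: pending_def)
  then obtain q where q: "sched r s = Some q"
    by (cases "sched r s") (auto simp: sends_unscheduled)
  define r' where "r' = continue_with r t (Some p, MsgIn q (snd (sends A V r s ! i)), s, i)"
  have "agree r r' t" by (simp add: r'_def)
  then have "sched r' s = Some q" "sends A V r' s = sends A V r s"
    using agreeD(1)[of r r' t s] sends_agree[of r r' t s A V] s(1) q by simp_all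
  moreover have "input r' t = MsgIn q (snd (sends A V r s ! i))" "src r' t = (s, i)"
    by (simp_all add: r'_def)
  ultimately have "valid_receipt A V r' t p"
    using s unfolding valid_receipt_def by (auto simp: prod_eq_iff)
  then show thesis using that unfolding r'_def by blast
qed

lemma fair_step_agree:
  assumes "agree r r' (Suc t)" "fair_step A V r t p"
  shows "fair_step A V r' t p"
proof -
  have "agree r r' t" using assms(1) agree_mono le_SucI by blast
  then show ?thesis
    using assms(2) pending_agree[of r r' t A V p] waiting_agree[of r r' t t A V p]
      valid_receipt_agree[OF assms(1)] agreeD[OF assms(1), of t]
    by (auto simp: fair_step_def split: if_splits)
qed

lemma fair_step_exists:
  assumes "\<not> waiting A V r t p"
  obtains inp x where "fair_step A V (continue_with r t (Some p, inp, x)) t p"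
proof -
  have unaffected: "pending A V (continue_with r t e) t p = pending A V r t p"
    "\<not> waiting A V (continue_with r t e) t p" for e
    using pending_agree[OF agree_continue_with] waiting_agree[OF agree_continue_with] assms
    by (metis, metis order_refl)
  show thesis
  proof (cases "pending A V r t p = {}")
    case True
    then have "fair_step A V (continue_with r t (Some p, NullIn, 0, 0)) t p"
      using unaffected by (simp add: fair_step_def)
    then show thesis by (rule that)
  next
    case False
    then obtain x where oldest: "x \<in> pending A V r t p" "\<forall>y\<in>pending A V r t p. fst x \<le> fst y"
      using ex_has_least_nat[of "\<lambda>x. x \<in> pending A V r t p" _ fst] by (metis ex_in_conv)
    then obtain inp where "valid_receipt A V (continue_with r t (Some p, inp, x)) t p"
      using pending_receivable[of "fst x" "snd x"] by (metis prod.collapse)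
    then have "fair_step A V (continue_with r t (Some p, inp, x)) t p"
      using oldest unaffected False by (simp add: fair_step_def)
    then show thesis by (rule that)
  qed
qed

lemma fair_stepD:
  assumes "fair_step A V r t p"
  shows "sched r t = Some p" "\<not> waiting A V r t p" "input r t = NullIn \<or> valid_receipt A V r t p"
  using assms by (auto simp: fair_step_def split: if_splits)

lemma fair_step_pending:
  assumes "fair_step A V r t p" "is_msg (input r t)"
  shows "valid_receipt A V r t p" "src r t \<in> pending A V r t p"
  using assms by (auto simp: fair_step_def split: if_splits)

lemma fair_step_legal: "fair_step A V r t p \<Longrightarrow> p \<in> Pi \<Longrightarrow> legal_step A Pi V r t p"
  using fair_stepD[of A V r t p] by (simp add: legal_step_def)

lemma fair_step_fresh:
  assumes "fair_step A V r t p" "is_msg (input r t)"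
    and "valid_receipt A V r s q" "s < t" "sched r s = Some q"
  shows "src r s \<noteq> src r t"
proof
  assume eq: "src r s = src r t"
  then have "q = p"
    using valid_receipt_receiver_unique[OF assms(3) fair_step_pending(1)[OF assms(1,2)]] by simp
  then show False
    using fair_step_pending(2)[OF assms(1,2)] assms(4,5) valid_receipt_is_msg[OF assms(3)] eq
    by (auto simp: pending_def)
qed

lemma legal_fair_step:
  assumes "legal A Pi V r t" "fair_step A V r t p" "p \<in> Pi"
  shows "legal A Pi V r (Suc t)"
proof (rule legal_Suc[OF assms(1)])
  show "legal_step A Pi V r t q" if "sched r t = Some q" for q
    using that assms(2,3) fair_stepD(1) fair_step_legal by fastforce
  fix s assume "t \<in> receipts r" "s \<in> receipts r" "s < t"
  then obtain q where "sched r s = Some q" "valid_receipt A V r s q"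
    using legal_step_receipt legalD[OF assms(1)] by (metis receiptsE)
  then show "src r s \<noteq> src r t"
    using fair_step_fresh[OF assms(2)] \<open>t \<in> receipts r\<close> \<open>s < t\<close> by (auto simp: receipts_def)
qed

lemma fair_step_extension:
  assumes "legal A Pi V r t" "query_free A V r t" "p \<in> Pi"
  obtains r' where "agree r r' t" "fair_step A V r' t p" "legal A Pi V r' (Suc t)"
proof -
  obtain inp x where "fair_step A V (continue_with r t (Some p, inp, x)) t p"
    using fair_step_exists[OF query_free_not_waiting[OF assms(2)]] by blast
  then show thesis
    using that legal_fair_step[OF legal_agree[OF agree_continue_with assms(1)] _ assms(3)]
      agree_continue_with by blast
qed

lemma fair_delivery:
  assumes inf: "\<And>T. \<exists>s\<ge>T. fair_step A V r s p"
    and msg: "i < length (sends A V r t)" "sends A V r t ! i = (p, m)"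
  shows "\<exists>s. sched r s = Some p \<and> is_msg (input r s) \<and> src r s = (t, i)"
proof (rule ccontr)
  assume undelivered: "\<not> ?thesis"
  define S where "S = {s. t < s \<and> fair_step A V r s p}"
  have "(t, i) \<in> pending A V r s p" if "t < s" for s
    using that msg undelivered by (auto simp: pending_def)
  then have S: "sched r s = Some p" "is_msg (input r s)" "src r s \<in> pending A V r s p"
      "fst (src r s) \<le> t" if "s \<in> S" for s
    using that valid_receipt_is_msg[of A V r s p]
    by (fastforce simp: S_def fair_step_def split: if_splits)+
  have "infinite S"
  proof
    assume "finite S"
    then obtain k where "\<forall>s\<in>S. s \<le> k" by (auto simp: finite_nat_set_iff_bounded_le)
    moreover obtain s where s: "Suc (max t k) \<le> s" "fair_step A V r s p" using inf by blast
    then have "s \<in> S" by (simp add: S_def)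
    ultimately show False using s(1) by auto
  qed
  moreover have "inj_on (src r) S"
  proof (rule linorder_inj_onI)
    fix x y assume "x < y" "x \<in> S" "y \<in> S"
    then show "src r x \<noteq> src r y"
      using S(3)[of y] S(1,2)[of x] by (auto simp: pending_def)
  qed auto
  moreover have "src r ` S \<subseteq> Sigma {..t} (\<lambda>s. {..<length (sends A V r s)})"
    using S(3,4) by (fastforce simp: pending_def)
  ultimately show False
    by (meson finite_SigmaI finite_atMost finite_lessThan finite_imageD finite_subset)
qed

section \<open>Runs\<close>

definition admissible_input ::
    "('s, 'm) algorithm \<Rightarrow> (nat \<Rightarrow> bool) \<Rightarrow> 'm schedule \<Rightarrow> nat \<Rightarrow> nat \<Rightarrow> bool" where
  "admissible_input A V r t p \<longleftrightarrow>
     (if waiting A V r t p then input r t = RespIn (resp r (nr r t p))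
      else input r t = NullIn \<or> valid_receipt A V r t p)"

lemma legal_step_admissible: "legal_step A Pi V r t p \<Longrightarrow> admissible_input A V r t p"
  by (simp add: legal_step_def admissible_input_def)

lemma is_run_sched:
  assumes "is_run A Pi F V P2 f2 r" "sched r t = Some p"
  shows "p \<in> Pi \<and> p \<notin> F t"
  using assms(1)[unfolded is_run_def, THEN conjunct1] assms(2) by blast

lemma is_run_legal:
  assumes "is_run A Pi F V P2 f2 r" "query_free A V r t"
  shows "legal A Pi V r (Suc t)"
  unfolding legal_def
proof (intro conjI allI impI)
  have input: "admissible_input A V r s p" if "sched r s = Some p" for s p
    using assms(1)[unfolded is_run_def, THEN conjunct2, THEN conjunct1] that
    unfolding admissible_input_def valid_receipt_def by blast
  fix s p assume "s < Suc t" and p: "sched r s = Some p"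
  then have "\<not> waiting A V r s p"
    using query_free_not_waiting[OF query_free_mono[OF assms(2)]] by (simp add: less_Suc_eq_le)
  then show "legal_step A Pi V r s p"
    using input[OF p] is_run_sched[OF assms(1) p] by (simp add: legal_step_def admissible_input_def)
next
  show "inj_on (src r) (receipts r \<inter> {..<Suc t})"
    using assms(1)[unfolded is_run_def, THEN conjunct2, THEN conjunct2, THEN conjunct1]
    unfolding inj_on_def receipts_def by blast
qed

lemma is_run_if_fair:
  assumes steps: "\<And>t p. sched r t = Some p \<Longrightarrow> p \<in> Pi \<and> p \<notin> F t"
    and inputs: "\<And>t p. sched r t = Some p \<Longrightarrow> admissible_input A V r t p"
    and unduplicated: "inj_on (src r) (receipts r)"
    and fair: "\<And>p t. p \<in> correct Pi F \<Longrightarrow> \<not> blocked A V r p \<Longrightarrow> \<exists>s\<ge>t. fair_step A V r s p"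
    and safe: "\<And>t p W. sched r t = Some p \<Longrightarrow> is_resp (input r t) \<Longrightarrow>
      \<forall>q b. queried A V r t (nr r t p) q b \<longrightarrow> W q = b \<Longrightarrow> resp r (nr r t p) \<in> P2 F W"
    and live: "\<And>p k. p \<in> correct Pi F \<Longrightarrow> queried_ever A V r k p \<Longrightarrow>
      card Pi - f2 \<le> card {q \<in> Pi. queried_ever A V r k q} \<Longrightarrow>
      \<exists>t. sched r t = Some p \<and> is_resp (input r t) \<and> nr r t p = k"
  shows "is_run A Pi F V P2 f2 r"
  unfolding is_run_def valid_receipt_def[symmetric] admissible_input_def[symmetric]
proof (intro conjI)
  show "\<forall>t t'. sched r t \<noteq> None \<and> sched r t' \<noteq> None \<and> is_msg (input r t) \<and> is_msg (input r t') \<and>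
      src r t = src r t' \<longrightarrow> t = t'"
    using unduplicated unfolding inj_on_def receipts_def by blast
  show "\<forall>t i p m. i < length (sends A V r t) \<and> sends A V r t ! i = (p, m) \<and> p \<in> correct Pi F \<longrightarrow>
      (\<exists>t'. sched r t' = Some p \<and> is_msg (input r t') \<and> src r t' = (t, i)) \<or> blocked A V r p"
    using fair_delivery[of A V r] fair by blast
  show "\<forall>p\<in>correct Pi F. (\<forall>t. \<exists>t'\<ge>t. sched r t' = Some p) \<or> blocked A V r p"
    using fair fair_stepD(1) by blast
qed (use steps inputs safe live in blast)+

lemma query_free_fair_is_run:
  assumes legal: "\<And>t. legal A Pi V r t" and free: "\<And>t. query_free A V r t"
    and fair: "\<And>p t. p \<in> Pi \<Longrightarrow> \<exists>s\<ge>t. fair_step A V r s p"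
  shows "is_run A Pi (\<lambda>_. {}) V P2 f2 r"
proof (rule is_run_if_fair)
  have legal_steps: "legal_step A Pi V r t p" if "sched r t = Some p" for t p
    using legalD[OF legal[of "Suc t"]] that by simp
  show "p \<in> Pi \<and> p \<notin> {}" if "sched r t = Some p" for t p
    using legal_steps[OF that] by (simp add: legal_step_def)
  show "admissible_input A V r t p" if "sched r t = Some p" for t p
    using legal_step_admissible[OF legal_steps[OF that]] .
  show "inj_on (src r) (receipts r)"
  proof (rule inj_onI)
    fix s t assume "s \<in> receipts r" "t \<in> receipts r" "src r s = src r t"
    then show "s = t"
      using inj_onD[OF legal_inj[OF legal[of "Suc (max s t)"]], of s t] by auto
  qed
  show "\<exists>s\<ge>t. fair_step A V r s p" if "p \<in> correct Pi (\<lambda>_. {})" for p t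
    using fair that by (simp add: correct_def)
  show "resp r (nr r t p) \<in> P2 (\<lambda>_. {}) W" if "sched r t = Some p" "is_resp (input r t)" for t p W
    using legal_step_no_resp[OF legal_steps] that by blast
  have "qout A V r t = None" for t
    using free[of "Suc t"] by (simp add: query_free_Suc)
  then have "\<not> queried_ever A V r k p" for k p
    by (simp add: queried_ever_def)
  then show "\<exists>t. sched r t = Some p \<and> is_resp (input r t) \<and> nr r t p = k"
    if "queried_ever A V r k p" for p k
    using that by blast
qed

section \<open>Extending a legal prefix by crashing processes\<close>

definition crash_at :: "nat \<Rightarrow> nat set \<Rightarrow> fpattern" where
  "crash_at t Z = (\<lambda>s. if s < t then {} else Z)"

lemma failure_pattern_crash_at: "Z \<subseteq> Pi \<Longrightarrow> failure_pattern Pi (crash_at t Z)"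
  by (auto simp: failure_pattern_def crash_at_def mono_def)

lemma faulty_crash_at [simp]: "faulty (crash_at t Z) = Z"
  by (auto simp: faulty_def crash_at_def)

lemma correct_crash_at [simp]: "correct Pi (crash_at t Z) = Pi - Z"
  by (simp add: correct_def)

definition turn :: "nat \<Rightarrow> nat \<Rightarrow> nat" where
  "turn n s = Suc (s mod n)"

lemma turn_in_range: "0 < n \<Longrightarrow> turn n s \<in> {1..n}"
  by (simp add: turn_def Suc_leI)

lemma turn_recurs:
  assumes "p \<in> {1..n}"
  obtains s where "t \<le> s" "turn n s = p"
proof -
  obtain k where k: "p = Suc k" "k < n" using assms by (cases p) auto
  show thesis
  proof (rule that)
    show "t \<le> t * n + k" using k(2) by (cases n) auto
    show "turn n (t * n + k) = p" using k by (simp add: turn_def)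
  qed
qed

text \<open>Consultation 0 has to be answered if processes in \<open>Z\<close> may have queried in it. No process in
  \<open>Z\<close> queries in a later consultation, which may therefore stay unanswered if \<open>Z\<close> has \<open>f + 1\<close>
  members.\<close>

abbreviation answered :: "bool option \<Rightarrow> nat \<Rightarrow> bool" where
  "answered ans k \<equiv> ans \<noteq> None \<and> k = 0"

definition crash_step :: "('s, 'm) algorithm \<Rightarrow> nat \<Rightarrow> (nat \<Rightarrow> bool) \<Rightarrow> nat set \<Rightarrow> bool option \<Rightarrow>
    'm schedule \<Rightarrow> nat \<Rightarrow> bool" where
  "crash_step A n V Z ans r s \<longleftrightarrow> (let p = turn n s in
     if p \<in> Z then sched r s = None
     else if waiting A V r s p then
       (if answered ans (nr r s p) then sched r s = Some p \<and> input r s = RespIn (the ans)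
        else sched r s = None)
     else fair_step A V r s p)"

lemma crash_step_exists: "\<exists>e. crash_step A n V Z ans (continue_with r s e) s"
proof -
  let ?p = "turn n s"
  have unaffected: "waiting A V (continue_with r s e) s ?p = waiting A V r s ?p"
      "nr (continue_with r s e) s ?p = nr r s ?p" for e
    using waiting_agree[OF agree_continue_with] nr_agree[OF agree_continue_with]
    by (metis order_refl)+
  consider (idle) "?p \<in> Z \<or> waiting A V r s ?p \<and> \<not> answered ans (nr r s ?p)"
    | (response) "?p \<notin> Z" "waiting A V r s ?p" "answered ans (nr r s ?p)"
    | (fair) "?p \<notin> Z" "\<not> waiting A V r s ?p"
    by blast
  then show ?thesis
  proof cases
    case idle
    then show ?thesis
      by (intro exI[of _ idle])
         (auto simp: crash_step_def Let_def unaffected sched_continue_with_idle)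
  next
    case response
    then show ?thesis
      by (intro exI[of _ "(Some ?p, RespIn (the ans), 0, 0)"])
         (simp add: crash_step_def Let_def unaffected)
  next
    case fair
    then obtain inp x where "fair_step A V (continue_with r s (Some ?p, inp, x)) s ?p"
      using fair_step_exists by blast
    with fair show ?thesis
      by (intro exI[of _ "(Some ?p, inp, x)"]) (simp add: crash_step_def Let_def unaffected)
  qed
qed

lemma crash_step_agree:
  assumes "agree r r' (Suc s)" "crash_step A n V Z ans r s"
  shows "crash_step A n V Z ans r' s"
proof -
  have "waiting A V r s p = waiting A V r' s p" "nr r s p = nr r' s p" for p
    using waiting_agree[OF assms(1)] nr_agree[OF assms(1)] by (metis le_SucI order_refl)+
  then show ?thesis
    using assms(2) fair_step_agree[OF assms(1)] agreeD[OF assms(1), of s]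
    unfolding crash_step_def Let_def by (metis lessI)
qed

locale crash_run =
  fixes A :: "('s, 'm) algorithm" and n f :: nat and V :: "nat \<Rightarrow> bool" and Z :: "nat set"
    and ans :: "bool option" and r :: "'m schedule" and t :: nat
  assumes legal: "legal A {1..n} V r t"
    and crashed: "Z \<subseteq> {1..n}" "card Z = f + 1"
    and answer_queried: "ans = Some b \<Longrightarrow> \<exists>q. queried A V r t 0 q b"
    and crashed_silent:
      "ans = None \<Longrightarrow> s < t \<Longrightarrow> sched r s = Some q \<Longrightarrow> qout A V r s \<noteq> None \<Longrightarrow> q \<notin> Z"
    and steps: "t \<le> s \<Longrightarrow> crash_step A n V Z ans r s"
    and resp: "resp r = (\<lambda>_. the ans)"
begin

lemma step_cases:
  assumes "sched r s = Some p" "t \<le> s"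
  obtains (response) "p = turn n s" "p \<notin> Z" "waiting A V r s p" "answered ans (nr r s p)"
      "input r s = RespIn (the ans)"
    | (fair) "p = turn n s" "p \<notin> Z" "fair_step A V r s p"
  using steps[OF assms(2)] assms(1)
  by (auto simp: crash_step_def Let_def fair_step_def split: if_splits)

lemma sched_alive:
  assumes "sched r s = Some p"
  shows "p \<in> {1..n} \<and> p \<notin> crash_at t Z s"
proof (cases "s < t")
  case True
  then show ?thesis using legalD[OF legal True assms] by (simp add: legal_step_def crash_at_def)
next
  case False
  have "0 < n" using crashed by (cases n) auto
  from assms False have "p = turn n s" "p \<notin> Z" by (auto elim: step_cases)
  then show ?thesis using False turn_in_range[OF \<open>0 < n\<close>] by (simp add: crash_at_def)
qed

lemma inputs_admissible:
  assumes "sched r s = Some p"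
  shows "admissible_input A V r s p"
proof (cases "s < t")
  case True
  then show ?thesis using legal_step_admissible[OF legalD[OF legal _ assms]] by simp
next
  case False
  then have "t \<le> s" by simp
  from assms this show ?thesis
    by (cases rule: step_cases)
       (use fair_stepD[of A V r s p] resp in \<open>auto simp: admissible_input_def\<close>)
qed

lemma receipt_valid:
  assumes "sched r s = Some p" "is_msg (input r s)"
  shows "valid_receipt A V r s p"
  using inputs_admissible[OF assms(1)] assms(2)
  by (auto simp: admissible_input_def split: if_splits)

lemma late_receipt_fair:
  assumes "sched r s = Some p" "is_msg (input r s)" "t \<le> s"
  shows "fair_step A V r s p"
  using assms(1,3) by (cases rule: step_cases) (use assms(2) in auto)

lemma response_step:
  assumes "sched r s = Some p" "is_resp (input r s)"
  shows "t \<le> s" "answered ans (nr r s p)"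
proof -
  show "t \<le> s"
    using legal_step_no_resp[OF legalD[OF legal _ assms(1)]] assms(2) by (meson not_less)
  from assms(1) this show "answered ans (nr r s p)"
    by (cases rule: step_cases)
       (use assms(2) fair_stepD(3)[of A V r s p] in \<open>auto simp: valid_receipt_def\<close>)
qed

lemma sources_inj: "inj_on (src r) (receipts r)"
proof (rule linorder_inj_onI)
  fix s s' assume "s < s'" "s \<in> receipts r" "s' \<in> receipts r"
  show "src r s \<noteq> src r s'"
  proof (cases "s' < t")
    case True
    then show ?thesis
      using inj_onD[OF legal_inj[OF legal], of s s'] \<open>s < s'\<close> \<open>s \<in> receipts r\<close> \<open>s' \<in> receipts r\<close>
      by auto
  next
    case False
    obtain p q where "sched r s = Some p" "is_msg (input r s)"
        "sched r s' = Some q" "is_msg (input r s')"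
      using \<open>s \<in> receipts r\<close> \<open>s' \<in> receipts r\<close> by (metis receiptsE)
    then show ?thesis
      using fair_step_fresh[OF late_receipt_fair _ receipt_valid \<open>s < s'\<close>] False by simp
  qed
qed auto

lemma blocked_if_unserved:
  assumes "t \<le> s" "waiting A V r s p" "\<not> answered ans (nr r s p)"
  shows "blocked A V r p"
proof -
  have "sched r u \<noteq> Some p" if "s \<le> u" "waiting A V r u p" "nr r u p = nr r s p" for u
  proof
    assume "sched r u = Some p"
    moreover have "t \<le> u" using assms(1) that(1) by simp
    ultimately show False
      by (cases rule: step_cases) (use that assms(3) fair_stepD(2)[of A V r u p] in auto)
  qed
  then show ?thesis using waits_forever_if_unserved[OF assms(2)] unfolding blocked_def by blast
qed

lemma correct_turn:
  assumes p: "p \<in> {1..n} - Z" "\<not> blocked A V r p" and s: "t \<le> s" "turn n s = p"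
  shows "sched r s = Some p \<and> is_resp (input r s) \<or> fair_step A V r s p"
  using steps[OF s(1)] blocked_if_unserved[OF s(1), of p] p s(2)
  by (auto simp: crash_step_def Let_def split: if_splits)

lemma infinitely_many_fair_steps:
  assumes p: "p \<in> {1..n} - Z" "\<not> blocked A V r p"
  shows "\<exists>s\<ge>u. fair_step A V r s p"
proof -
  obtain s where s: "max t u \<le> s" "turn n s = p" using turn_recurs p by blast
  consider (fair) "fair_step A V r s p" | (response) "sched r s = Some p" "is_resp (input r s)"
    using correct_turn[OF p _ s(2)] s(1) by auto
  then show ?thesis
  proof cases
    case fair
    then show ?thesis using s(1) by auto
  next
    case response
    obtain s' where s': "Suc s \<le> s'" "turn n s' = p" using turn_recurs p by blast
    then have "0 < nr r s' p" using response nr_pos_iff[of r s' p] by auto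
    then have "fair_step A V r s' p"
      using correct_turn[OF p _ s'(2)] response_step(2)[of s' p] s s' by auto
    then show ?thesis using s s' by (intro exI[of _ s']) auto
  qed
qed

lemma crashed_not_queried:
  assumes "queried_ever A V r k q" "\<not> answered ans k"
  shows "q \<notin> Z"
proof
  assume "q \<in> Z"
  obtain s c where s: "sched r s = Some q" "nq A V r s q = k" "qout A V r s = Some c"
    using assms(1) unfolding queried_ever_def by blast
  have "s < t" using sched_alive[OF s(1)] \<open>q \<in> Z\<close> by (auto simp: crash_at_def split: if_splits)
  then have "ans \<noteq> None" using crashed_silent[of s q] s(1,3) \<open>q \<in> Z\<close> by auto
  then have "0 < nq A V r s q" using assms(2) s(2) by simp
  then have "waiting A V r s q"
    using legal_nr[OF legal, of s q] \<open>s < t\<close> by (simp add: waiting_def)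
  then show False using legalD[OF legal \<open>s < t\<close> s(1)] by (simp add: legal_step_def)
qed

lemma few_queriers:
  assumes "\<not> answered ans k"
  shows "card {q \<in> {1..n}. queried_ever A V r k q} < n - f"
proof -
  have "card {q \<in> {1..n}. queried_ever A V r k q} \<le> card ({1..n} - Z)"
    by (rule card_mono) (use crashed_not_queried assms in auto)
  also have "\<dots> = n - (f + 1)" using crashed by (simp add: card_Diff_subset finite_subset)
  finally show ?thesis using crashed card_mono[of "{1..n}" Z] by simp
qed

lemma response_admissible:
  assumes "sched r s = Some p" "is_resp (input r s)"
    and W: "\<forall>q c. queried A V r s (nr r s p) q c \<longrightarrow> W q = c"
  shows "resp r (nr r s p) \<in> cons_problem {1..n} F W"
proof -
  note response = response_step[OF assms(1,2)]
  obtain b where b: "ans = Some b" using response(2) by blast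
  then obtain q where q: "queried A V r t 0 q b" using answer_queried by blast
  then have "queried A V r s 0 q b" using response(1) unfolding queried_def by (meson less_le_trans)
  then have "W q = b" using W response(2) by simp
  moreover have "q \<in> {1..n}" using q sched_alive unfolding queried_def by blast
  ultimately show ?thesis using b unfolding cons_problem_def resp by auto
qed

lemma first_consultation_answered:
  assumes p: "p \<in> {1..n} - Z" and "ans \<noteq> None" "queried_ever A V r 0 p"
  shows "\<exists>s. sched r s = Some p \<and> is_resp (input r s) \<and> nr r s p = 0"
proof (rule ccontr)
  assume never: "\<not> ?thesis"
  obtain s where s: "sched r s = Some p" "qout A V r s \<noteq> None"
    using assms(3) unfolding queried_ever_def by auto
  obtain u where u: "max t (Suc s) \<le> u" "turn n u = p" using turn_recurs p by blast
  have "nr r u p = 0" using never response_step(2)[of _ p] nr_pos_iff[of r u p] by blast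
  moreover have "0 < nq A V r u p" using s u(1) nq_pos_iff[of A V r u p] by auto
  ultimately have "sched r u = Some p \<and> is_resp (input r u)"
    using steps[of u] u p \<open>ans \<noteq> None\<close> by (auto simp: crash_step_def waiting_def)
  then show False using never \<open>nr r u p = 0\<close> by blast
qed

lemma is_run: "is_run A {1..n} (crash_at t Z) V (cons_problem {1..n}) f r"
proof (rule is_run_if_fair)
  fix p k
  assume p: "p \<in> correct {1..n} (crash_at t Z)" "queried_ever A V r k p"
    and "card {1..n} - f \<le> card {q \<in> {1..n}. queried_ever A V r k q}"
  then have "answered ans k"
    using few_queriers[of k] by (metis card_atLeastAtMost diff_Suc_1 not_less)
  then show "\<exists>s. sched r s = Some p \<and> is_resp (input r s) \<and> nr r s p = k"
    using first_consultation_answered[of p] p by simp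
qed (use sched_alive inputs_admissible sources_inj infinitely_many_fair_steps response_admissible
     in simp_all)

lemma not_waiting_if_scheduled:
  assumes "ans = None" "t \<le> s" "sched r s = Some p"
  shows "\<not> waiting A V r s p"
  using assms(3,2) by (cases rule: step_cases) (use assms(1) fair_stepD(2)[of A V r s p] in auto)

end

lemma crash_extension:
  assumes "legal A {1..n} V r t" "Z \<subseteq> {1..n}" "card Z = f + 1"
    and "\<And>b. ans = Some b \<Longrightarrow> \<exists>q. queried A V r t 0 q b"
    and "\<And>s q. ans = None \<Longrightarrow> s < t \<Longrightarrow> sched r s = Some q \<Longrightarrow> qout A V r s \<noteq> None \<Longrightarrow> q \<notin> Z"
  obtains r' where "agree r r' t" "crash_run A n f V Z ans r' t"
proof -
  obtain r1 where r1: "agree r r1 t" "\<And>s. t \<le> s \<Longrightarrow> crash_step A n V Z ans r1 s"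
    using stepwise_extension[of "crash_step A n V Z ans" r t] crash_step_exists
      crash_step_agree[of _ _ _ A n V Z ans] by metis
  define r' where "r' = schedule_of (event r1) (\<lambda>_. the ans)"
  have "agree r1 r' u" for u by (simp add: agree_def r'_def)
  then have steps: "crash_step A n V Z ans r' s" if "t \<le> s" for s
    using crash_step_agree r1(2)[OF that] by blast
  have agree: "agree r r' t" using r1(1) \<open>agree r1 r' t\<close> by (rule agree_trans)
  have "crash_run A n f V Z ans r' t"
  proof
    show "legal A {1..n} V r' t" using legal_agree[OF agree assms(1)] .
    show "\<exists>q. queried A V r' t 0 q b" if "ans = Some b" for b
      using assms(4)[OF that] queried_agree[OF agree] by blast
    show "q \<notin> Z" if "ans = None" "s < t" "sched r' s = Some q" "qout A V r' s \<noteq> None" for s q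
      using assms(5) that agreeD[OF agree] qout_agree[OF agree] by metis
  qed (use assms steps in \<open>auto simp: r'_def\<close>)
  with agree show thesis by (rule that)
qed

section \<open>Prefixes that differ in the steps of few processes\<close>

text \<open>Initial values may differ only if no common step precedes the difference: a common step of a
  process in \<open>Z\<close> could send different messages.\<close>

definition differ_within ::
    "nat set \<Rightarrow> nat \<Rightarrow> nat \<Rightarrow> (nat \<Rightarrow> bool) \<Rightarrow> 'm schedule \<Rightarrow> (nat \<Rightarrow> bool) \<Rightarrow> 'm schedule \<Rightarrow> bool" where
  "differ_within Z t u V r V' r' \<longleftrightarrow>
     (\<forall>p. p \<notin> Z \<longrightarrow> V p = V' p) \<and> (0 < t \<longrightarrow> V = V') \<and> agree r r' t \<and>
     (\<forall>s p. t \<le> s \<and> s < u \<and> (sched r s = Some p \<or> sched r' s = Some p) \<longrightarrow> p \<in> Z)"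

text \<open>The idle slots of \<open>R\<close> leave room for the steps of \<open>r\<close>, so that grafting does not change the
  identifier (sending time and index) of any message.\<close>

locale graft_after_difference =
  fixes A :: "('s, 'm) algorithm" and Pi Z :: "nat set" and t u T :: nat
    and V V' :: "nat \<Rightarrow> bool" and r R :: "'m schedule"
  assumes differ: "differ_within Z t u V r V' R"
    and R_idle: "t \<le> s \<Longrightarrow> s < u \<Longrightarrow> sched R s = None"
    and R_avoids: "u \<le> s \<Longrightarrow> sched R s = Some p \<Longrightarrow> p \<notin> Z"
    and legal_r: "legal A Pi V r u"
    and legal_R: "legal A Pi V' R T"
    and free_R: "query_free A V' R (T - 1)"
    and t_le_u: "t \<le> u"
begin

abbreviation (input) grafted :: "'m schedule" where
  "grafted \<equiv> graft r R u"

lemma legal_before_graft: "legal A Pi V grafted u"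
  by (rule legal_agree[OF agree_graft legal_r])

lemma agree_R: "agree grafted R t"
  using differ agree_trans[OF agree_mono[OF agree_sym[OF agree_graft] t_le_u]]
  unfolding differ_within_def by blast

lemma event_grafted: "s < t \<or> u \<le> s \<Longrightarrow> event grafted s = event R s"
  using agree_R by (auto simp: agree_def event_graft)

lemma sched_between:
  assumes "t \<le> s" "s < u" "sched grafted s = Some p"
  shows "p \<in> Z"
proof -
  have "event grafted s = event r s" using assms(2) by (simp add: event_graft)
  then show ?thesis using differ assms event_eqD(1) unfolding differ_within_def by metis
qed

lemma cfg_grafted: "p \<notin> Z \<Longrightarrow> cfg A V grafted s p = cfg A V' R s p"
proof (induction s)
  case 0
  then show ?case using differ by (simp add: differ_within_def)
next
  case (Suc s)
  show ?case
  proof (cases "t \<le> s \<and> s < u")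
    case True
    then have "sched grafted s \<noteq> Some p" using sched_between Suc.prems by blast
    then show ?thesis using Suc R_idle True by (auto split: option.split)
  next
    case False
    then have "event grafted s = event R s" using event_grafted by auto
    then show ?thesis using Suc event_eqD[of grafted s R s] by (auto split: option.split)
  qed
qed

lemma outputs_grafted:
  assumes "s < t \<or> u \<le> s"
  shows "sends A V grafted s = sends A V' R s" "qout A V grafted s = qout A V' R s"
proof -
  have "sends A V grafted s = sends A V' R s \<and> qout A V grafted s = qout A V' R s"
  proof (cases "s < t")
    case True
    then have "V = V'" using differ by (auto simp: differ_within_def)
    then show ?thesis using sends_agree[OF agree_R True] qout_agree[OF agree_R True] by blast
  next
    case False
    then have "u \<le> s" using assms by simp
    then have "cfg A V grafted s p = cfg A V' R s p" if "sched R s = Some p" for p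
      using cfg_grafted R_avoids that by blast
    then show ?thesis
      using event_eqD[OF event_grafted[OF assms]]
      by (auto simp: sends_def qout_def split: option.split)
  qed
  then show "sends A V grafted s = sends A V' R s" "qout A V grafted s = qout A V' R s" by blast+
qed

lemma not_waiting_grafted:
  assumes "p \<notin> Z" "s < T"
  shows "\<not> waiting A V grafted s p"
proof -
  have "qout A V grafted s' = None" if "s' < s" "sched grafted s' = Some p" for s'
  proof -
    have "s' < t \<or> u \<le> s'" using sched_between that(2) assms(1) not_less by blast
    moreover have "qout A V' R s' = None"
      using free_R that(1) assms(2) by (simp add: query_free_def)
    ultimately show ?thesis using outputs_grafted(2) by simp
  qed
  then show ?thesis using nq_pos_iff[of A V grafted s p] by (auto simp: waiting_def)
qed

lemma valid_receipt_grafted: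
  assumes "u \<le> s" "valid_receipt A V' R s p"
  shows "valid_receipt A V grafted s p"
proof -
  obtain q m where R: "input R s = MsgIn q m" "fst (src R s) < s" "sched R (fst (src R s)) = Some q"
      "snd (src R s) < length (sends A V' R (fst (src R s)))"
      "sends A V' R (fst (src R s)) ! snd (src R s) = (p, m)"
    using assms(2) unfolding valid_receipt_def by blast
  then have sent: "fst (src R s) < t \<or> u \<le> fst (src R s)" using R_idle[of "fst (src R s)"] by force
  have "event grafted s = event R s" using event_grafted assms(1) by blast
  then show ?thesis
    using R event_eqD[of grafted s R s] event_eqD(1)[OF event_grafted[OF sent]]
      outputs_grafted(1)[OF sent]
    unfolding valid_receipt_def by simp
qed

lemma legal_step_grafted:
  assumes "s < T" "sched grafted s = Some p"
  shows "legal_step A Pi V grafted s p"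
proof (cases "s < u")
  case True
  then show ?thesis using legalD[OF legal_before_graft] assms(2) by blast
next
  case False
  then have eq: "event grafted s = event R s" and "u \<le> s" using event_grafted by auto
  then have R: "sched R s = Some p" using event_eqD(1) assms(2) by metis
  have "\<not> waiting A V grafted s p"
    using not_waiting_grafted R_avoids[OF \<open>u \<le> s\<close> R] assms(1) by blast
  then show ?thesis
    using legalD[OF legal_R assms(1) R] valid_receipt_grafted[OF \<open>u \<le> s\<close>] event_eqD(2)[OF eq]
    by (auto simp: legal_step_def)
qed

lemma sources_inj_grafted: "inj_on (src grafted) (receipts grafted \<inter> {..<T})"
proof (rule linorder_inj_onI)
  fix s s'
  assume "s < s'" and s: "s \<in> receipts grafted \<inter> {..<T}" and s': "s' \<in> receipts grafted \<inter> {..<T}"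
  consider (from_r) "s' < u" | (from_R) "u \<le> s'" "s < t \<or> u \<le> s"
    | (mixed) "u \<le> s'" "t \<le> s" "s < u" by linarith
  then show "src grafted s \<noteq> src grafted s'"
  proof cases
    case from_r
    then show ?thesis
      using inj_onD[OF legal_inj[OF legal_before_graft], of s s'] s s' \<open>s < s'\<close> by auto
  next
    case from_R
    have "event grafted s = event R s" "event grafted s' = event R s'"
      using from_R event_grafted by blast+
    then show ?thesis
      using inj_onD[OF legal_inj[OF legal_R], of s s'] s s' \<open>s < s'\<close> event_eqD
      unfolding receipts_def by (metis (mono_tags, lifting) IntE IntI less_irrefl mem_Collect_eq)
  next
    case mixed
    obtain p p' where p: "sched grafted s = Some p" "sched grafted s' = Some p'"
        "is_msg (input grafted s)" "is_msg (input grafted s')"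
      using s s' by (metis IntD1 receiptsE)
    have "p \<in> Z" using sched_between mixed p(1) by blast
    moreover have "p' \<notin> Z" using R_avoids mixed(1) p(2) event_eqD(1) event_grafted by metis
    moreover have "valid_receipt A V grafted s p" "valid_receipt A V grafted s' p'"
      using legal_step_receipt[OF legal_step_grafted] p s s' by simp_all
    ultimately show ?thesis using valid_receipt_receiver_unique by blast
  qed
qed auto

lemma legal_grafted: "legal A Pi V grafted T"
  using legal_step_grafted sources_inj_grafted by (simp add: legal_def)

end

section \<open>Reachable outcomes\<close>

locale consensus_reduction =
  fixes A :: "('s, 'm) algorithm" and n f :: nat
  assumes bounds: "1 \<le> f" "f + 2 \<le> n"
    and solves: "solves_with A {1..n} (Cons_task n (f + 1)) (Cons_task n f)"
begin

definition run :: "fpattern \<Rightarrow> (nat \<Rightarrow> bool) \<Rightarrow> 'm schedule \<Rightarrow> bool" where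
  "run F V r \<longleftrightarrow> failure_pattern {1..n} F \<and> card (faulty F) \<le> f + 1
     \<and> is_run A {1..n} F V (cons_problem {1..n}) f r"

definition decision :: "(nat \<Rightarrow> bool) \<Rightarrow> 'm schedule \<Rightarrow> nat \<Rightarrow> nat \<Rightarrow> bool option" where
  "decision V r t p = a_dec A p (cfg A V r t p)"

definition outcomes :: "(nat \<Rightarrow> bool) \<Rightarrow> 'm schedule \<Rightarrow> nat \<Rightarrow> bool set" where
  "outcomes V r t =
     {v. \<exists>F r' p s. run F V r' \<and> agree r r' t \<and> p \<in> {1..n} \<and> decision V r' s p = Some v}"

lemma run_solves:
  assumes "run F V r"
  shows "(\<forall>p\<in>correct {1..n} F. \<exists>t d. decision V r t p = Some d)
      \<and> (\<forall>p\<in>{1..n}. \<forall>t t' d. t \<le> t' \<and> decision V r t p = Some d \<longrightarrow> decision V r t' p = Some d)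
      \<and> (\<forall>p\<in>{1..n}. \<forall>q\<in>{1..n}. \<forall>t t' d d'. decision V r t p = Some d
            \<and> decision V r t' q = Some d' \<longrightarrow> d = d')
      \<and> (\<forall>p\<in>{1..n}. \<forall>t d. decision V r t p = Some d \<longrightarrow> d \<in> cons_problem {1..n} F V)"
  using solves assms unfolding solves_with_def Cons_task_def run_def decision_def fst_conv snd_conv
  by blast

lemma correct_decides:
  "run F V r \<Longrightarrow> p \<in> {1..n} \<Longrightarrow> p \<notin> faulty F \<Longrightarrow> \<exists>t d. decision V r t p = Some d"
  using run_solves[of F V r] unfolding correct_def by blast

lemma decision_irrevocable:
  "run F V r \<Longrightarrow> p \<in> {1..n} \<Longrightarrow> decision V r t p = Some d \<Longrightarrow> t \<le> t' \<Longrightarrow> decision V r t' p = Some d"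
  using run_solves[of F V r] by blast

lemma decisions_equal:
  "run F V r \<Longrightarrow> p \<in> {1..n} \<Longrightarrow> q \<in> {1..n} \<Longrightarrow> decision V r t p = Some d \<Longrightarrow>
    decision V r t' q = Some d' \<Longrightarrow> d = d'"
  using run_solves[of F V r] by blast

lemma decision_valid:
  "run F V r \<Longrightarrow> p \<in> {1..n} \<Longrightarrow> decision V r t p = Some d \<Longrightarrow> d \<in> cons_problem {1..n} F V"
  using run_solves[of F V r] by blast

lemma run_sched: "run F V r \<Longrightarrow> sched r s = Some p \<Longrightarrow> p \<in> {1..n}"
  using is_run_sched unfolding run_def by blast

lemma run_legal: "run F V r \<Longrightarrow> query_free A V r t \<Longrightarrow> legal A {1..n} V r (Suc t)"
  using is_run_legal unfolding run_def by blast

lemma decision_agree: "agree r r' t \<Longrightarrow> s \<le> t \<Longrightarrow> decision V r s p = decision V r' s p"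
  unfolding decision_def using cfg_agree by metis

lemma exists_process_outside:
  assumes "finite Z" "card Z \<le> f + 1"
  obtains p where "p \<in> {1..n}" "p \<notin> Z"
proof -
  have "card Z < card {1..n}" using assms(2) bounds by simp
  then have "\<not> {1..n} \<subseteq> Z" using card_mono[OF assms(1), of "{1..n}"] by auto
  then show thesis using that by blast
qed

lemma run_decides:
  assumes "run F V r"
  obtains p t v where "p \<in> {1..n}" "p \<notin> faulty F" "decision V r t p = Some v"
proof -
  have "faulty F \<subseteq> {1..n}"
    using assms unfolding run_def failure_pattern_def faulty_def by blast
  then obtain p where "p \<in> {1..n}" "p \<notin> faulty F"
    using exists_process_outside assms finite_subset unfolding run_def by blast
  then show thesis using correct_decides[OF assms] that by blast
qed

lemma crash_superset:
  assumes "S \<subseteq> {1..n}" "card S \<le> f + 1"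
  obtains Z where "S \<subseteq> Z" "Z \<subseteq> {1..n}" "card Z = f + 1"
  using exists_subset_between[OF assms(2) _ assms(1)] bounds by auto

lemma crash_avoiding:
  assumes "p \<in> {1..n}"
  obtains Z where "p \<notin> Z" "Z \<subseteq> {1..n}" "card Z = f + 1"
proof -
  have "f + 1 \<le> card ({1..n} - {p})" using bounds assms by simp
  then obtain Z where "Z \<subseteq> {1..n} - {p}" "card Z = f + 1" by (meson obtain_subset_with_card_n)
  then show thesis using that by blast
qed

lemma crash_run_is_run:
  assumes "crash_run A n f V Z ans r t"
  shows "run (crash_at t Z) V r"
proof -
  interpret crash_run A n f V Z ans r t by fact
  show ?thesis using is_run crashed by (simp add: run_def failure_pattern_crash_at)
qed

lemma silent_extension:
  assumes "legal A {1..n} V r t" "Z \<subseteq> {1..n}" "card Z = f + 1"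
    "\<And>s q. s < t \<Longrightarrow> sched r s = Some q \<Longrightarrow> qout A V r s \<noteq> None \<Longrightarrow> q \<notin> Z"
  obtains r' where "agree r r' t" "run (crash_at t Z) V r'"
    "\<And>s p. t \<le> s \<Longrightarrow> sched r' s = Some p \<Longrightarrow> p \<notin> Z \<and> \<not> waiting A V r' s p"
proof -
  obtain r' where r': "agree r r' t" "crash_run A n f V Z None r' t"
    using crash_extension[OF assms(1-3), of None] assms(4) by blast
  interpret crash_run A n f V Z None r' t by fact
  have "p \<notin> Z \<and> \<not> waiting A V r' s p" if "t \<le> s" "sched r' s = Some p" for s p
    using sched_alive[OF that(2)] not_waiting_if_scheduled[OF _ that] that(1)
    by (simp add: crash_at_def)
  then show thesis using that r'(1) crash_run_is_run[OF r'(2)] by blast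
qed

lemma query_free_extension:
  assumes "legal A {1..n} V r t" "query_free A V r t" "Z \<subseteq> {1..n}" "card Z = f + 1"
  obtains r' where "agree r r' t" "run (crash_at t Z) V r'"
    "\<forall>s\<ge>t. \<forall>p. sched r' s = Some p \<longrightarrow> p \<notin> Z"
proof (rule silent_extension[OF assms(1,3,4)])
  show "q \<notin> Z" if "s < t" "qout A V r s \<noteq> None" for s q
    using assms(2) that by (simp add: query_free_def)
qed (use that in blast)

lemma legal_extends_to_run:
  assumes "legal A {1..n} V r t"
  obtains F r' where "run F V r'" "agree r r' t"
proof -
  obtain Z where Z: "Z \<subseteq> {1..n}" "card Z = f + 1" using crash_superset[of "{}"] by auto
  show thesis
  proof (cases "query_free A V r t")
    case True
    obtain r' where "agree r r' t" "run (crash_at t Z) V r'"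
      using query_free_extension[OF assms True Z] .
    then show thesis using that by blast
  next
    case False
    then obtain q b where "queried A V r t 0 q b" by (rule queried_if_not_query_free)
    then show thesis
      using crash_extension[OF assms Z, of "Some b"] crash_run_is_run that
      by (metis option.inject option.distinct(1))
  qed
qed

lemma outcomesI:
  "run F V r' \<Longrightarrow> agree r r' t \<Longrightarrow> p \<in> {1..n} \<Longrightarrow> decision V r' s p = Some v \<Longrightarrow> v \<in> outcomes V r t"
  unfolding outcomes_def by blast

lemma outcomesE:
  assumes "v \<in> outcomes V r t"
  obtains F r' p s where "run F V r'" "agree r r' t" "p \<in> {1..n}" "decision V r' s p = Some v"
  using assms unfolding outcomes_def by blast

lemma outcomes_antimono:
  assumes "agree r r' t" "t \<le> t'"
  shows "outcomes V r' t' \<subseteq> outcomes V r t"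
  unfolding outcomes_def using agree_trans[OF assms(1) agree_mono[OF _ assms(2)]] by blast

lemma outcomes_decided:
  assumes "decision V r s p = Some v" "s \<le> t" "p \<in> {1..n}"
  shows "outcomes V r t \<subseteq> {v}"
proof
  fix w assume "w \<in> outcomes V r t"
  then obtain F r' q u
    where r': "run F V r'" "agree r r' t" "q \<in> {1..n}" "decision V r' u q = Some w"
    by (rule outcomesE)
  then have "decision V r' s p = Some v" using decision_agree[OF r'(2) assms(2)] assms(1) by metis
  then show "w \<in> {v}" using decisions_equal[OF r'(1,3) assms(3) r'(4)] by blast
qed

lemma decision_in_outcomes:
  assumes "legal A {1..n} V r t" "p \<in> {1..n}" "decision V r t p = Some v"
  shows "v \<in> outcomes V r t"
proof -
  obtain F r' where r': "run F V r'" "agree r r' t" using legal_extends_to_run[OF assms(1)] .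
  then have "decision V r' t p = Some v"
    using decision_agree[OF r'(2)] assms(3) by (metis order_refl)
  then show ?thesis using outcomesI[OF r' assms(2)] by blast
qed

lemma outcomes_nonempty:
  assumes "legal A {1..n} V r t"
  shows "outcomes V r t \<noteq> {}"
proof -
  obtain F r' where r': "run F V r'" "agree r r' t" using legal_extends_to_run[OF assms] .
  obtain p s v where "p \<in> {1..n}" "decision V r' s p = Some v" using run_decides[OF r'(1)] .
  then have "v \<in> outcomes V r t" by (rule outcomesI[OF r'])
  then show ?thesis by blast
qed

section \<open>Undecided processes cannot query\<close>

lemma first_querier_decided:
  assumes legal: "legal A {1..n} V r (Suc s)" and free: "query_free A V r s"
    and p: "sched r s = Some p" "qout A V r s \<noteq> None"
  shows "decision V r (Suc s) p \<noteq> None"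
proof -
  have "p \<in> {1..n}" using legalD[OF legal _ p(1)] by (simp add: legal_step_def)
  then obtain Z where Z: "p \<notin> Z" "Z \<subseteq> {1..n}" "card Z = f + 1" by (rule crash_avoiding)
  have "q \<notin> Z" if "u < Suc s" "sched r u = Some q" "qout A V r u \<noteq> None" for u q
    using that free p(1) Z(1) by (auto simp: query_free_def less_Suc_eq)
  then obtain r' where r': "agree r r' (Suc s)" "run (crash_at (Suc s) Z) V r'"
      "\<And>u q. Suc s \<le> u \<Longrightarrow> sched r' u = Some q \<Longrightarrow> q \<notin> Z \<and> \<not> waiting A V r' u q"
    using silent_extension[OF legal Z(2,3)] by blast
  have "nr r' (Suc s) p = 0" using legal_nr[OF legal_agree[OF r'(1) legal]] by simp
  moreover have "0 < nq A V r' (Suc s) p"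
    using nq_pos_iff[of A V r "Suc s" p] nq_agree[OF r'(1), of "Suc s" A V p] p by auto
  ultimately have "waiting A V r' (Suc s) p" by (simp add: waiting_def)
  then have stuck: "sched r' u \<noteq> Some p" if "Suc s \<le> u" for u
    using waits_forever_if_unserved[of A V r' "Suc s" p u] r'(3) that by blast
  have "p \<notin> faulty (crash_at (Suc s) Z)" using Z(1) by simp
  then obtain T d where "decision V r' T p = Some d"
    using correct_decides[OF r'(2) \<open>p \<in> {1..n}\<close>] by blast
  then have "decision V r' (max T (Suc s)) p = Some d"
    by (rule decision_irrevocable[OF r'(2) \<open>p \<in> {1..n}\<close> _ max.cobounded1])
  moreover have "cfg A V r' (max T (Suc s)) p = cfg A V r' (Suc s) p"
    by (rule cfg_unscheduled) (use stuck in auto)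
  ultimately have "decision V r' (Suc s) p = Some d" by (simp add: decision_def)
  then show ?thesis using decision_agree[OF r'(1), of "Suc s" V p] by simp
qed

lemma query_free_if_undecided:
  assumes "query_free A V r t"
    and "\<And>s. t \<le> s \<Longrightarrow> s < T \<Longrightarrow> query_free A V r s \<Longrightarrow> legal A {1..n} V r (Suc s)"
    and "\<And>s p. t \<le> s \<Longrightarrow> s < T \<Longrightarrow> sched r s = Some p \<Longrightarrow> decision V r (Suc s) p = None"
  shows "query_free A V r T"
  using assms(2,3)
proof (induction T)
  case (Suc s)
  then have free: "query_free A V r s" by simp
  have "qout A V r s = None"
  proof (cases "s < t")
    case True
    then show ?thesis using assms(1) by (simp add: query_free_def)
  next
    case False
    show ?thesis
    proof (rule ccontr)
      assume query: "qout A V r s \<noteq> None"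
      then obtain p where p: "sched r s = Some p" using qout_unscheduled by (metis not_None_eq)
      have "legal A {1..n} V r (Suc s)" using Suc.prems(1) free False by simp
      then have "decision V r (Suc s) p \<noteq> None" using free p query by (rule first_querier_decided)
      then show False using Suc.prems(2)[OF _ _ p] False by simp
    qed
  qed
  with free show ?case by (simp add: query_free_Suc)
qed simp

lemma first_decision_query_free:
  assumes r: "run F V r" and free: "query_free A V r t"
    and active: "\<forall>s\<ge>t. \<forall>p. sched r s = Some p \<longrightarrow> p \<in> S"
    and S: "S \<subseteq> {1..n}" "p \<in> S" "decision V r s p = Some d"
  obtains T q v where "t \<le> T" "q \<in> S" "decision V r T q = Some v"
    "query_free A V r (T - 1)" "legal A {1..n} V r T"
proof -
  define T0 where "T0 = (LEAST T. \<exists>q\<in>S. decision V r T q \<noteq> None)"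
  have "\<exists>T. \<exists>q\<in>S. decision V r T q \<noteq> None" using S(2,3) by auto
  then obtain q v where q: "q \<in> S" "decision V r T0 q = Some v"
    using LeastI_ex[of "\<lambda>T. \<exists>q\<in>S. decision V r T q \<noteq> None"] unfolding T0_def by blast
  have before: "decision V r T q = None" if "T < T0" "q \<in> S" for T q
    using not_less_Least that unfolding T0_def by blast
  have "query_free A V r (T0 - 1)"
    by (rule query_free_if_undecided[OF free]) (use run_legal[OF r] before active in auto)
  then have free_T: "query_free A V r (max T0 t - 1)"
    using free query_free_mono[OF free, of "t - 1"] by (cases "T0 \<le> t") (simp_all add: max_def)
  then have "legal A {1..n} V r (max T0 t)"
    by (intro legal_mono[OF run_legal[OF r]]) auto
  moreover have "decision V r (max T0 t) q = Some v"
    using decision_irrevocable[OF r _ q(2)] q(1) S(1) by auto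
  ultimately show thesis using that[of "max T0 t" q v] q(1) free_T by simp
qed

section \<open>Valency\<close>

lemma decision_without_crashed:
  assumes "legal A {1..n} V r t" "query_free A V r t" "t \<le> u" and Z: "Z \<subseteq> {1..n}" "card Z = f + 1"
  obtains R T p d where "agree r R t" "\<forall>s\<in>{t..<u}. sched R s = None"
    "\<forall>s\<ge>u. \<forall>q. sched R s = Some q \<longrightarrow> q \<notin> Z"
    "u \<le> T" "p \<in> {1..n} - Z" "decision V R T p = Some d"
    "query_free A V R (T - 1)" "legal A {1..n} V R T"
proof -
  let ?halted = "continue_with r t idle"
  have free: "query_free A V ?halted u" using query_free_continue_idle[OF assms(2)] .
  obtain R where R: "agree ?halted R u" "run (crash_at u Z) V R"
      and avoids: "\<forall>s\<ge>u. \<forall>q. sched R s = Some q \<longrightarrow> q \<notin> Z"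
    using query_free_extension[OF legal_continue_idle[OF assms(1)] free Z] .
  have agree: "agree r R t"
    using agree_trans[OF agree_continue_with agree_mono[OF R(1) \<open>t \<le> u\<close>]] .
  have idle: "\<forall>s\<in>{t..<u}. sched R s = None"
    using sched_continue_with_idle agreeD(1)[OF R(1)] by (metis atLeastLessThan_iff)
  obtain p s d where "p \<in> {1..n}" "p \<notin> faulty (crash_at u Z)"
      and decided: "decision V R s p = Some d"
    using run_decides[OF R(2)] .
  then have alive: "p \<in> {1..n} - Z" by simp
  have "\<forall>s\<ge>u. \<forall>q. sched R s = Some q \<longrightarrow> q \<in> {1..n} - Z"
    using avoids run_sched[OF R(2)] by blast
  then obtain T q v where "u \<le> T" "q \<in> {1..n} - Z" "decision V R T q = Some v"
      "query_free A V R (T - 1)" "legal A {1..n} V R T"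
    using first_decision_query_free
        [OF R(2) query_free_agree[OF R(1) free] _ Diff_subset alive decided] by metis
  with agree idle avoids show thesis by (rule that)
qed

lemma grafted_decision_in_outcomes:
  assumes "graft_after_difference A {1..n} Z t u T V V' r R" and "u \<le> T"
    and "p \<in> {1..n} - Z" "decision V' R T p = Some d"
  shows "d \<in> outcomes V r u"
proof -
  interpret graft_after_difference A "{1..n}" Z t u T V V' r R by fact
  have "decision V grafted T p = Some d"
    using cfg_grafted[of p T] assms(3,4) by (simp add: decision_def)
  then have "d \<in> outcomes V grafted T"
    using decision_in_outcomes[OF legal_grafted] assms(3) by blast
  then show ?thesis using outcomes_antimono[OF agree_graft \<open>u \<le> T\<close>] by blast
qed

lemma outcomes_meet_if_differ_within:
  assumes legal: "legal A {1..n} V r u" "legal A {1..n} V' r' u" and free: "query_free A V r t"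
    and differ: "differ_within Z t u V r V' r'" and "t \<le> u"
    and Z: "Z \<subseteq> {1..n}" "card Z \<le> f + 1"
  shows "outcomes V r u \<inter> outcomes V' r' u \<noteq> {}"
proof -
  obtain C where C: "Z \<subseteq> C" "C \<subseteq> {1..n}" "card C = f + 1" using crash_superset[OF Z] .
  obtain R T p d where R: "agree r R t" "\<forall>s\<in>{t..<u}. sched R s = None"
      "\<forall>s\<ge>u. \<forall>q. sched R s = Some q \<longrightarrow> q \<notin> C"
    and decided: "u \<le> T" "p \<in> {1..n} - C" "decision V R T p = Some d"
    and free_R: "query_free A V R (T - 1)" and legal_R: "legal A {1..n} V R T"
    using decision_without_crashed[OF legal_mono[OF legal(1) \<open>t \<le> u\<close>] free \<open>t \<le> u\<close> C(2,3)] .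
  have outcome: "d \<in> outcomes W \<rho> u"
    if "legal A {1..n} W \<rho> u" "differ_within C t u W \<rho> V R" for W \<rho>
  proof (rule grafted_decision_in_outcomes[OF _ decided])
    show "graft_after_difference A {1..n} C t u T W V \<rho> R"
      by unfold_locales (use that R(2,3) free_R legal_R \<open>t \<le> u\<close> in auto)
  qed
  have within: "q \<in> C" if "t \<le> s" "s < u" "sched r s = Some q \<or> sched r' s = Some q" for s q
    using differ that C(1) unfolding differ_within_def by blast
  have "agree r r' t" using differ by (simp add: differ_within_def)
  then have "agree r' R t" by (rule agree_trans[OF agree_sym R(1)])
  then have "differ_within C t u V r V R" "differ_within C t u V' r' V R"
    using differ within R(1,2) C(1) unfolding differ_within_def by auto
  then show ?thesis using outcome legal by blast
qed

lemma consecutive_outcomes_meet: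
  assumes legal: "legal A {1..n} V e (Suc s)" "legal A {1..n} V r (Suc (Suc s))"
    and agree: "agree r e s" and free: "query_free A V r s"
    and p: "p \<in> {1..n}" "sched e s = Some p" "sched r (Suc s) \<in> {None, Some p}"
  shows "outcomes V e (Suc s) \<inter> outcomes V r (Suc (Suc s)) \<noteq> {}"
proof -
  let ?e = "continue_with e (Suc s) idle" and ?Z = "insert p (set_option (sched r s))"
  have agree': "agree e ?e (Suc s)" by simp
  have "outcomes V r (Suc (Suc s)) \<inter> outcomes V ?e (Suc (Suc s)) \<noteq> {}"
  proof (rule outcomes_meet_if_differ_within[OF legal(2) legal_continue_idle[OF legal(1)] free])
    have "sched ?e s = Some p" "sched ?e (Suc s) = None"
      using agreeD(1)[OF agree', of s] p(2) sched_continue_with_idle[of "Suc s" "Suc s" e]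
      by simp_all
    moreover have "agree r ?e s" using agree_trans[OF agree agree_mono[OF agree']] by simp
    ultimately show "differ_within ?Z s (Suc (Suc s)) V r V ?e"
      using p(3) unfolding differ_within_def by (auto simp: less_Suc_eq)
    show "?Z \<subseteq> {1..n}"
      using legalD[OF legal(2), of s] p(1) by (auto simp: legal_step_def)
    show "card ?Z \<le> f + 1"
      using bounds card_insert_le_m1[of 2 "set_option (sched r s)" p] by (cases "sched r s") auto
  qed simp
  then show ?thesis using outcomes_antimono[OF agree', of "Suc (Suc s)"] by fastforce
qed

definition bivalent :: "(nat \<Rightarrow> bool) \<Rightarrow> 'm schedule \<Rightarrow> nat \<Rightarrow> bool" where
  "bivalent V r t \<longleftrightarrow> outcomes V r t = UNIV"

lemma outcomes_univalent:
  assumes "\<not> bivalent V r t" "v \<in> outcomes V r t"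
  shows "outcomes V r t = {v}"
  using assms unfolding bivalent_def by (auto simp: UNIV_bool) (metis (full_types))+

lemma outcomes_constant:
  assumes "\<And>p. p \<in> {1..n} \<Longrightarrow> V p = c"
  shows "outcomes V r t \<subseteq> {c}"
proof
  fix v assume "v \<in> outcomes V r t"
  then obtain F r' q s where r': "run F V r'" "q \<in> {1..n}" "decision V r' s q = Some v"
    by (rule outcomesE)
  then have "v \<in> cons_problem {1..n} F V" using decision_valid by blast
  then show "v \<in> {c}" using assms r'(2) unfolding cons_problem_def by (auto split: if_splits)
qed

lemma initially_bivalent:
  obtains V where "bivalent V r 0"
proof (rule ccontr)
  assume "\<not> thesis"
  then have univalent: "\<not> bivalent V r 0" for V using that by blast
  define W :: "nat \<Rightarrow> nat \<Rightarrow> bool" where "W j p \<longleftrightarrow> p \<le> j" for j p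
  have "j \<le> n \<Longrightarrow> outcomes (W j) r 0 = {False}" for j
  proof (induction j)
    case 0
    have "outcomes (W 0) r 0 \<subseteq> {False}" by (rule outcomes_constant) (simp add: W_def)
    then show ?case using outcomes_nonempty[OF legal_0] by blast
  next
    case (Suc j)
    have "differ_within {Suc j} 0 0 (W j) r (W (Suc j)) r"
      by (auto simp: differ_within_def W_def)
    then have "outcomes (W j) r 0 \<inter> outcomes (W (Suc j)) r 0 \<noteq> {}"
      by (rule outcomes_meet_if_differ_within[OF legal_0 legal_0 query_free_0])
         (use Suc.prems in auto)
    then show ?case using Suc outcomes_univalent[OF univalent] by auto
  qed
  moreover have "outcomes (W n) r 0 \<subseteq> {True}" by (rule outcomes_constant) (simp add: W_def)
  ultimately show False by auto
qed

lemma bivalent_undecided: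
  assumes "bivalent V r t" "s \<le> t" "p \<in> {1..n}"
  shows "decision V r s p = None"
proof (rule ccontr)
  assume "decision V r s p \<noteq> None"
  then obtain v where "decision V r s p = Some v" by blast
  then have "outcomes V r t \<subseteq> {v}" using assms(2,3) by (rule outcomes_decided)
  then show False using assms(1) by (auto simp: bivalent_def UNIV_bool)
qed

lemma bivalent_query_free:
  assumes legal: "legal A {1..n} V r t" and "bivalent V r t"
  shows "query_free A V r t"
proof (rule query_free_if_undecided)
  show "legal A {1..n} V r (Suc s)" if "s < t" for s using legal_mono[OF legal] that by simp
  show "decision V r (Suc s) p = None" if "s < t" "sched r s = Some p" for s p
    using bivalent_undecided[OF assms(2)] legalD[OF legal that] that(1)
    by (simp add: legal_step_def)
qed (rule query_free_0)

definition fair_extension :: "(nat \<Rightarrow> bool) \<Rightarrow> 'm schedule \<Rightarrow> nat \<Rightarrow> nat \<Rightarrow> 'm schedule \<Rightarrow> bool" where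
  "fair_extension V r s p e \<longleftrightarrow>
     agree r e s \<and> fair_step A V e s p \<and> legal A {1..n} V e (Suc s)"

lemma fair_extension_exists:
  assumes "legal A {1..n} V r s" "query_free A V r s" "p \<in> {1..n}"
  obtains e where "fair_extension V r s p e"
  using fair_step_extension[OF assms] unfolding fair_extension_def by blast

lemma fair_extension_outcomes_meet:
  assumes e: "fair_extension V r s p e" and "legal A {1..n} V r' (Suc (Suc s))"
    and r': "agree r r' (Suc s)" "sched r' (Suc s) \<in> {None, Some p}"
    and "query_free A V r s" "p \<in> {1..n}"
  shows "outcomes V e (Suc s) \<inter> outcomes V r' (Suc (Suc s)) \<noteq> {}"
proof (rule consecutive_outcomes_meet)
  have "agree r r' s" using agree_mono[OF r'(1)] by simp
  then show "agree r' e s" "query_free A V r' s"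
    using agree_trans[OF agree_sym] query_free_agree assms(5) e
    unfolding fair_extension_def by blast+
qed (use assms fair_stepD(1) in \<open>auto simp: fair_extension_def\<close>)

lemma univalent_fair_extensions:
  assumes legal: "legal A {1..n} V R T" and free: "query_free A V R (T - 1)" and p: "p \<in> {1..n}"
    and univalent: "\<And>s e. t \<le> s \<Longrightarrow> fair_extension V R s p e \<Longrightarrow> \<not> bivalent V e (Suc s)"
    and start: "fair_extension V R t p e" "v \<in> outcomes V e (Suc t)"
    and s: "t \<le> s" "s < T"
  obtains e where "fair_extension V R s p e" "outcomes V e (Suc s) = {v}"
proof -
  have "s < T \<longrightarrow> (\<exists>e. fair_extension V R s p e \<and> outcomes V e (Suc s) = {v})"
    using s(1)
  proof (induction s rule: dec_induct)
    case base
    then show ?case using start outcomes_univalent univalent by blast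
  next
    case (step s)
    show ?case
    proof
      assume "Suc s < T"
      then obtain e where e: "fair_extension V R s p e" "outcomes V e (Suc s) = {v}"
        using step.IH by auto
      have "legal A {1..n} V R (Suc s)" "query_free A V R (Suc s)"
        using legal_mono[OF legal] query_free_mono[OF free] \<open>Suc s < T\<close> by auto
      then obtain e' where e': "fair_extension V R (Suc s) p e'"
        using fair_extension_exists p by blast
      then have "agree R e' (Suc s)" "sched e' (Suc s) = Some p" "legal A {1..n} V e' (Suc (Suc s))"
        using fair_stepD(1) unfolding fair_extension_def by blast+
      then have "outcomes V e (Suc s) \<inter> outcomes V e' (Suc (Suc s)) \<noteq> {}"
        using fair_extension_outcomes_meet[OF e(1)] query_free_mono[OF free, of s] p \<open>Suc s < T\<close>
        by simp
      then show "\<exists>e. fair_extension V R (Suc s) p e \<and> outcomes V e (Suc (Suc s)) = {v}"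
        using e(2) e' outcomes_univalent[OF univalent[OF _ e']] step.hyps by auto
    qed
  qed
  then show thesis using that s(2) by blast
qed

lemma bivalent_reaches_decision:
  assumes "bivalent V r t"
  obtains R T p where "agree r R t" "t < T" "p \<in> {1..n}" "decision V R T p = Some v"
    "query_free A V R (T - 1)" "legal A {1..n} V R T"
proof -
  have "v \<in> outcomes V r t" using assms by (simp add: bivalent_def)
  then obtain F R q s where R: "run F V R" "agree r R t" "q \<in> {1..n}" "decision V R s q = Some v"
    by (rule outcomesE)
  have "\<forall>s\<ge>0. \<forall>q. sched R s = Some q \<longrightarrow> q \<in> {1..n}" using run_sched[OF R(1)] by blast
  then obtain T p w where p: "p \<in> {1..n}" "decision V R T p = Some w"
      and prefix: "query_free A V R (T - 1)" "legal A {1..n} V R T"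
    using first_decision_query_free[OF R(1) query_free_0 _ subset_refl R(3,4)] by metis
  have "decision V R T p = Some v" using decisions_equal[OF R(1,3) p(1) R(4) p(2)] p(2) by simp
  moreover have "t < T"
  proof (rule ccontr)
    assume "\<not> t < T"
    then have "decision V R T p = None"
      using bivalent_undecided[OF assms _ p(1), of T] decision_agree[OF R(2), of T V p] by simp
    then show False using p(2) by simp
  qed
  ultimately show thesis using that R(2) p(1) prefix by blast
qed

lemma bivalent_fair_extension:
  assumes legal: "legal A {1..n} V r t" and biv: "bivalent V r t" and p: "p \<in> {1..n}"
  shows "\<exists>r' s. t \<le> s \<and> agree r r' t \<and> fair_step A V r' s p \<and> legal A {1..n} V r' (Suc s) \<and>
    bivalent V r' (Suc s)"
proof (rule ccontr)
  assume none: "\<not> ?thesis"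
  have univalent: "\<not> bivalent V e (Suc s)"
    if "t \<le> s" "agree r R t" "fair_extension V R s p e" for R s e
    using none that agree_trans[OF that(2) agree_mono[of R e s t]]
    unfolding fair_extension_def by blast
  obtain e0 where e0: "fair_extension V r t p e0"
    using fair_extension_exists[OF legal bivalent_query_free[OF legal biv] p] .
  then obtain v where v: "v \<in> outcomes V e0 (Suc t)"
    using outcomes_nonempty[of V e0 "Suc t"] unfolding fair_extension_def by blast
  obtain R T q where R: "agree r R t" "t < T"
      and decided: "q \<in> {1..n}" "decision V R T q = Some (\<not> v)"
      and prefix: "query_free A V R (T - 1)" "legal A {1..n} V R T"
    using bivalent_reaches_decision[OF biv] .
  obtain s where s: "T = Suc s" "t \<le> s" using \<open>t < T\<close> by (cases T) auto
  have "fair_extension V R t p e0"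
    using e0 agree_trans[OF agree_sym[OF R(1)]] unfolding fair_extension_def by blast
  then obtain e where e: "fair_extension V R s p e" "outcomes V e (Suc s) = {v}"
    using univalent_fair_extensions[OF prefix(2,1) p] univalent[OF _ R(1)] v s by blast
  have "outcomes V e (Suc s) \<inter> outcomes V (continue_with R T idle) (Suc (Suc s)) \<noteq> {}"
    by (rule fair_extension_outcomes_meet[OF e(1) legal_continue_idle[OF prefix(2)]])
       (use prefix(1) p sched_continue_with_idle[of T T R] s(1) in auto)
  then have "v \<in> outcomes V R T"
    using e(2) outcomes_antimono[OF agree_continue_with, of T "Suc (Suc s)" V R idle] s(1) by auto
  then show False using outcomes_decided[OF decided(2) order_refl decided(1)] by auto
qed

lemma bivalent_agree:
  assumes "agree r r' t" "bivalent V r t" "s \<le> t"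
  shows "bivalent V r' s"
  using outcomes_antimono[OF agree_mono[OF agree_sym[OF assms(1)] assms(3)] assms(3)] assms(2)
  unfolding bivalent_def by blast

lemma forever_bivalent_fair_schedule:
  obtains V r where "\<And>t. legal A {1..n} V r t" "\<And>t. bivalent V r t"
    "\<And>p t. p \<in> {1..n} \<Longrightarrow> \<exists>s\<ge>t. fair_step A V r s p"
proof -
  fix r0 :: "'m schedule"
  obtain V where "bivalent V r0 0" using initially_bivalent .
  define P where "P j r t \<longleftrightarrow> legal A {1..n} V r t \<and> bivalent V r t \<and>
      (\<forall>i. j = Suc i \<longrightarrow> (\<exists>s. t = Suc s \<and> fair_step A V r s (turn n i)))" for j r t
  have base: "P 0 r0 0" using \<open>bivalent V r0 0\<close> by (simp add: P_def)
  have step: "\<exists>r' t'. t < t' \<and> agree r r' t \<and> P (Suc j) r' t'" if "P j r t" for j r t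
  proof -
    have "turn n j \<in> {1..n}" using turn_in_range bounds by simp
    moreover have "legal A {1..n} V r t" "bivalent V r t" using that by (simp_all add: P_def)
    ultimately obtain r' s where "t \<le> s" "agree r r' t" "fair_step A V r' s (turn n j)"
        "legal A {1..n} V r' (Suc s)" "bivalent V r' (Suc s)"
      using bivalent_fair_extension[of V r t "turn n j"] by blast
    then show ?thesis by (intro exI[of _ r'] exI[of _ "Suc s"]) (simp add: P_def)
  qed
  obtain r T where "strict_mono T" and limit: "\<And>j. \<exists>r'. P j r' (T j) \<and> agree r' r (T j)"
    by (rule dependent_limit[of P, OF base step]) (assumption | rule that)+
  have le_T: "t \<le> T t" for t using strict_mono_imp_increasing[OF \<open>strict_mono T\<close>] .
  show thesis
  proof
    show "legal A {1..n} V r t" "bivalent V r t" for t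
      using limit[of t] legal_agree legal_mono[OF _ le_T] bivalent_agree[OF _ _ le_T]
      unfolding P_def by blast+
    fix p t assume "p \<in> {1..n}"
    then obtain j where j: "t \<le> j" "turn n j = p" by (rule turn_recurs)
    obtain r' where "P (Suc j) r' (T (Suc j))" and agree: "agree r' r (T (Suc j))"
      using limit by blast
    then obtain s where "T (Suc j) = Suc s" "fair_step A V r' s p"
      using j(2) unfolding P_def by blast
    then show "\<exists>s\<ge>t. fair_step A V r s p"
      using fair_step_agree agree le_T[of "Suc j"] j(1) by (intro exI[of _ s]) auto
  qed
qed

lemma reduction_impossible: False
proof -
  obtain V r where legal: "\<And>t. legal A {1..n} V r t" and bivalent: "\<And>t. bivalent V r t"
      and fair: "\<And>p t. p \<in> {1..n} \<Longrightarrow> \<exists>s\<ge>t. fair_step A V r s p"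
    using forever_bivalent_fair_schedule by blast
  have "is_run A {1..n} (\<lambda>_. {}) V (cons_problem {1..n}) f r"
    using query_free_fair_is_run[OF legal bivalent_query_free[OF legal bivalent] fair] .
  then have "run (\<lambda>_. {}) V r"
    unfolding run_def by (simp add: failure_pattern_def faulty_def mono_def)
  then obtain p t v where "p \<in> {1..n}" "decision V r t p = Some v" by (rule run_decides)
  then show False using bivalent_undecided[OF bivalent order_refl, of p] by simp
qed

end

theorem mainTheorem14:
  fixes n f :: nat
  assumes "1 \<le> f" and "f \<le> n - 2"
  shows "\<not> (\<exists>A :: ('s, 'm) algorithm.
             solves_with A {1..n} (Cons_task n (f + 1)) (Cons_task n f))"
proof
  assume "\<exists>A :: ('s, 'm) algorithm. solves_with A {1..n} (Cons_task n (f + 1)) (Cons_task n f)"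
  then obtain A :: "('s, 'm) algorithm"
    where "solves_with A {1..n} (Cons_task n (f + 1)) (Cons_task n f)" by blast
  then interpret consensus_reduction A n f using assms by unfold_locales auto
  show False by (rule reduction_impossible)
qed

end
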